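(* Let $n>0$. Then $(\mathcal{W}(S_n),\leqslant)$ is graded, of rank ${n \choose 2}-{\lfloor \frac{n}{2}\rfloor \choose 2}$, and its rank function is $\ell_{\mathcal{W}}$.
   Context: For $n\in\mathbb{P}$, let $S_n$ be the symmetric group with Bruhat order $\leqslant$ and length $\ell(\sigma)=|\{(i,j):i<j,\ \sigma(i)>\sigma(j)\}|$ (number of inversions). Define the involution on $[n]$: $i^*=i-1$ if $i$ is even; $i^*=i+1$ if $i$ is odd and $i+1\in[n]$; $i^*=n$ otherwise. The set of Wachs permutations is $\mathcal{W}(S_n)=\{\sigma\in S_n: |\sigma^{-1}(i)-\sigma^{-1}(i^* )|\leq 1 \text{ for all } i\in[n-1]\}$, with the order induced by Bruhat order. Let $m=\lfloor n/2\rfloor$. Define $f_n:\mathcal{W}(S_n)\to S_m$ as follows: if $n=2m$ and $v\in\mathcal{W}(S_{2m})$, then for each $i\in[m]$ one has $\{v(2i-1),v(2i)\}=\{2\tau(i)-1,2\tau(i)\}$ for a unique $\tau\in S_m$, and $f_n(v)=\tau$; if $n=2m+1$, let $\chi_n(v)\in\mathcal{W}(S_{2m})$ be the word obtained from $v$ by deleting the letter $n$, and set $f_n(v)=f_{2m}(\chi_n(v))$. Finally $\ell_{\mathcal{W}}(v):=\ell(v)-\ell(f_n(v))$ for all $v\in\mathcal{W}(S_n)$. *)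

theory Defs
  imports Complex_Main "HOL-Combinatorics.Permutations"
begin

section \<open>Graded posets\<close>

text \<open>
  A poset is a carrier \<open>A\<close> together with a relation \<open>r\<close> such that \<open>partial_order_on A r\<close>;
  in particular \<open>r\<close> is contained in \<open>A \<times> A\<close>, so the members of \<open>Chains r\<close> are subsets of \<open>A\<close>.
\<close>

definition maximal_chain :: "'a rel \<Rightarrow> 'a set \<Rightarrow> bool" where
  "maximal_chain r C \<longleftrightarrow> C \<in> Chains r \<and> (\<forall>D \<in> Chains r. C \<subseteq> D \<longrightarrow> D = C)"

text \<open>A chain of length \<open>k\<close> has \<open>k + 1\<close> elements.\<close>

definition graded_of_rank :: "'a set \<Rightarrow> 'a rel \<Rightarrow> nat \<Rightarrow> bool" where
  "graded_of_rank A r k \<longleftrightarrow>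
     partial_order_on A r \<and> (\<forall>C. maximal_chain r C \<longrightarrow> finite C \<and> card C = k + 1)"

definition minimal_in :: "'a set \<Rightarrow> 'a rel \<Rightarrow> 'a \<Rightarrow> bool" where
  "minimal_in A r x \<longleftrightarrow> x \<in> A \<and> (\<forall>y \<in> A. (y, x) \<in> r \<longrightarrow> y = x)"

definition covered_by :: "'a set \<Rightarrow> 'a rel \<Rightarrow> 'a \<Rightarrow> 'a \<Rightarrow> bool" where
  "covered_by A r x y \<longleftrightarrow>
     x \<in> A \<and> y \<in> A \<and> x \<noteq> y \<and> (x, y) \<in> r \<and>
     (\<forall>z \<in> A. (x, z) \<in> r \<and> (z, y) \<in> r \<longrightarrow> z = x \<or> z = y)"

definition rank_function :: "'a set \<Rightarrow> 'a rel \<Rightarrow> ('a \<Rightarrow> int) \<Rightarrow> bool" where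
  "rank_function A r \<rho> \<longleftrightarrow>
     (\<forall>x. minimal_in A r x \<longrightarrow> \<rho> x = 0) \<and>
     (\<forall>x y. covered_by A r x y \<longrightarrow> \<rho> y = \<rho> x + 1)"


section \<open>The symmetric group and its Bruhat order\<close>

definition sym_group :: "nat \<Rightarrow> (nat \<Rightarrow> nat) set" where
  "sym_group n = {\<sigma>. \<sigma> permutes {1..n}}"

definition perm_length :: "nat \<Rightarrow> (nat \<Rightarrow> nat) \<Rightarrow> nat" where
  "perm_length n \<sigma> = card {(i, j). i \<in> {1..n} \<and> j \<in> {1..n} \<and> i < j \<and> \<sigma> i > \<sigma> j}"

text \<open>
  As in any Coxeter group, the Bruhat order is generated by the length-increasing
  multiplications by a reflection; the reflections of the symmetric group are the transpositions.
\<close>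

definition bruhat_step :: "nat \<Rightarrow> (nat \<Rightarrow> nat) rel" where
  "bruhat_step n = {(u, v). u \<in> sym_group n \<and>
     (\<exists>a \<in> {1..n}. \<exists>b \<in> {1..n}. a \<noteq> b \<and> v = u \<circ> transpose a b) \<and>
     perm_length n u < perm_length n v}"

definition bruhat :: "nat \<Rightarrow> (nat \<Rightarrow> nat) rel" where
  "bruhat n = Restr ((bruhat_step n)\<^sup>*) (sym_group n)"


section \<open>Wachs permutations\<close>

definition star :: "nat \<Rightarrow> nat \<Rightarrow> nat" where
  "star n i = (if even i then i - 1 else if i + 1 \<in> {1..n} then i + 1 else n)"

definition wachs :: "nat \<Rightarrow> (nat \<Rightarrow> nat) set" where
  "wachs n = {\<sigma> \<in> sym_group n.
     \<forall>i \<in> {1..n - 1}. \<bar>int (inv \<sigma> i) - int (inv \<sigma> (star n i))\<bar> \<le> 1}"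

definition wachs_order :: "nat \<Rightarrow> (nat \<Rightarrow> nat) rel" where
  "wachs_order n = Restr (bruhat n) (wachs n)"

definition word_of :: "nat \<Rightarrow> (nat \<Rightarrow> nat) \<Rightarrow> nat list" where
  "word_of n \<sigma> = map \<sigma> [1..<n + 1]"

text \<open>Words are 1-based: the letter in position \<open>i\<close> is \<open>w ! (i - 1)\<close>.\<close>

definition of_word :: "nat list \<Rightarrow> nat \<Rightarrow> nat" where
  "of_word w i = (if i \<in> {1..length w} then w ! (i - 1) else i)"

definition chi :: "nat \<Rightarrow> (nat \<Rightarrow> nat) \<Rightarrow> nat \<Rightarrow> nat" where
  "chi n v = of_word (filter (\<lambda>x. x \<noteq> n) (word_of n v))"

definition f_even :: "nat \<Rightarrow> (nat \<Rightarrow> nat) \<Rightarrow> nat \<Rightarrow> nat" where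
  "f_even m v = (THE \<tau>. \<tau> \<in> sym_group m \<and>
     (\<forall>i \<in> {1..m}. {v (2 * i - 1), v (2 * i)} = {2 * \<tau> i - 1, 2 * \<tau> i}))"

definition f_wachs :: "nat \<Rightarrow> (nat \<Rightarrow> nat) \<Rightarrow> nat \<Rightarrow> nat" where
  "f_wachs n v = (if even n then f_even (n div 2) v else f_even (n div 2) (chi n v))"

definition wachs_length :: "nat \<Rightarrow> (nat \<Rightarrow> nat) \<Rightarrow> int" where
  "wachs_length n v = int (perm_length n v) - int (perm_length (n div 2) (f_wachs n v))"

end

theory Submission
  imports Defs
begin

text \<open>
  Bruhat order is comparison of the rank matrices \<open>rk u i j = #{a \<le> i. u(a) \<ge> j}\<close>. A Wachs
  permutation of \<open>2m\<close> letters is a permutation \<open>\<tau> \<in> S\<^sub>m\<close> of blocks together with the set \<open>E\<close> of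
  descending blocks, and its Wachs length is \<open>3 \<ell>(\<tau>) + |E|\<close>; for \<open>2m + 1\<close> letters the letter
  \<open>2m + 1\<close> is inserted after \<open>p\<close> blocks, which adds \<open>2 (m - p)\<close>.

  It suffices to find, for \<open>u < v\<close> in the Wachs poset, a Wachs permutation \<open>w\<close> with \<open>u < w \<le> v\<close>
  whose Wachs length is one more than that of \<open>u\<close>. If the block permutations \<open>\<tau>\<close>, \<open>\<sigma>\<close> of \<open>u\<close>, \<open>v\<close>
  differ, let \<open>a\<close> be the first position where they do and \<open>b > a\<close> the first one with
  \<open>\<tau>(a) < \<tau>(b) \<le> \<sigma>(a)\<close>. If one of the blocks \<open>a\<close>, \<open>b\<close> is ascending, make it descending; otherwise
  exchange the two and make both ascending. If the largest letter of an odd Wachs permutation stands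
  further right in \<open>u\<close> than in \<open>v\<close>, then the block to its left is made descending or, if it is
  descending already, the letter jumps over it and the block becomes ascending.
\<close>

section \<open>A criterion for gradedness\<close>

text \<open>Iterating \<open>step\<close> makes \<open>\<rho>\<close> strictly increasing along
  \<open>r\<close>. A maximal chain contains \<open>lo\<close> and \<open>hi\<close>, and it cannot
  skip a value of \<open>\<rho>\<close>: an interpolated element would be comparable to the whole
  chain and hence belong to it. So \<open>\<rho>\<close> maps the chain bijectively onto
  \<open>{0..int k}\<close>.\<close>

lemma graded_by_interpolation:
  fixes \<rho> :: "'a \<Rightarrow> int"
  assumes po: "partial_order_on A r" and fin: "finite A"
    and lo: "\<And>x. x \<in> A \<Longrightarrow> (lo, x) \<in> r" and hi: "\<And>x. x \<in> A \<Longrightarrow> (x, hi) \<in> r"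
    and loA: "lo \<in> A" and hiA: "hi \<in> A"
    and \<rho>: "\<rho> lo = 0" "\<rho> hi = int k"
    and step: "\<And>x y. (x, y) \<in> r \<Longrightarrow> x \<noteq> y \<Longrightarrow>
      \<exists>z. (x, z) \<in> r \<and> (z, y) \<in> r \<and> \<rho> z = \<rho> x + 1"
  shows "graded_of_rank A r k \<and> rank_function A r \<rho>"
proof -
  have rA: "r \<subseteq> A \<times> A" and tr: "trans r" and anti: "antisym r" and rf: "refl_on A r"
    using po by (auto simp: partial_order_on_def preorder_on_def)
  \<comment> \<open>Induction on the size of the up-set, which shrinks strictly on passing from
    \<open>x\<close> to the interpolated \<open>z\<close>.\<close>
  have less: "\<rho> x < \<rho> y" if "(x, y) \<in> r" "x \<noteq> y" for x y
    using that
  proof (induction "card {w. (x, w) \<in> r}" arbitrary: x rule: less_induct)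
    case less
    obtain z where z: "(x, z) \<in> r" "(z, y) \<in> r" "\<rho> z = \<rho> x + 1"
      using step less.prems by blast
    show ?case
    proof (cases "z = y")
      case False
      have "z \<noteq> x" using z by auto
      have "finite {w. (x, w) \<in> r}"
        using rA fin by (auto intro: finite_subset)
      moreover have "{w. (z, w) \<in> r} \<subset> {w. (x, w) \<in> r}"
      proof
        show "{w. (z, w) \<in> r} \<subseteq> {w. (x, w) \<in> r}" using z tr by (auto dest: transD)
        have "(x, x) \<in> r" using rA z rf by (auto simp: refl_on_def)
        moreover have "(z, x) \<notin> r" using z anti \<open>z \<noteq> x\<close> by (auto dest: antisymD)
        ultimately show "{w. (z, w) \<in> r} \<noteq> {w. (x, w) \<in> r}" by blast
      qed
      ultimately have "card {w. (z, w) \<in> r} < card {w. (x, w) \<in> r}"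
        by (rule psubset_card_mono)
      from less.hyps[OF this z(2) False] z show ?thesis by simp
    qed (use z in auto)
  qed
  have card: "finite C \<and> card C = k + 1" if C: "maximal_chain r C" for C
  proof -
    have ch: "(x, y) \<in> r \<or> (y, x) \<in> r" if "x \<in> C" "y \<in> C" for x y
      using C that by (auto simp: maximal_chain_def Chains_def)
    have CA: "C \<subseteq> A" using ch rA by blast
    have finC: "finite C" using CA fin finite_subset by blast
    \<comment> \<open>The form in which maximality is used: whatever is comparable to all of
      \<open>C\<close> lies in \<open>C\<close>.\<close>
    have ext: "z \<in> C" if "z \<in> A" "\<And>c. c \<in> C \<Longrightarrow> (c, z) \<in> r \<or> (z, c) \<in> r" for z
    proof -
      have "(z, z) \<in> r" using that rf by (auto simp: refl_on_def)
      then have "insert z C \<in> Chains r" using that ch by (auto simp: Chains_def)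
      then show ?thesis using C by (auto simp: maximal_chain_def)
    qed
    have loC: "lo \<in> C" using ext loA lo CA by blast
    have hiC: "hi \<in> C" using ext hiA hi CA by blast
    have le: "\<rho> x \<le> \<rho> y" if "(x, y) \<in> r" for x y
      using less that by (cases "x = y") force+
    have inj: "inj_on \<rho> C"
    proof (rule inj_onI)
      fix x y assume "x \<in> C" "y \<in> C" "\<rho> x = \<rho> y"
      then show "x = y" using ch less by (metis less_irrefl)
    qed
    have cmp: "(x, y) \<in> r" if "x \<in> C" "y \<in> C" "\<rho> x \<le> \<rho> y" for x y
      using ch[OF that(1,2)] less[of y x] that rf CA by (force simp: refl_on_def)
    have up: "int j \<le> int k \<longrightarrow> int j \<in> \<rho> ` C" for j
    proof (induction j)
      case 0
      show ?case using loC \<rho> by force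
    next
      case (Suc j)
      show ?case
      proof
        assume jk: "int (Suc j) \<le> int k"
        then obtain x where x: "x \<in> C" "\<rho> x = int j" using Suc by auto
        \<comment> \<open>\<open>U\<close> contains \<open>hi\<close>. An element \<open>y\<close>
          of least value in it is the successor of \<open>x\<close> in the chain, so any point
          between \<open>x\<close> and \<open>y\<close> is comparable to all of
          \<open>C\<close>.\<close>
        define U where "U = {y \<in> C. \<rho> y > int j}"
        have U: "finite U" "U \<noteq> {}" using finC hiC \<rho> jk by (auto simp: U_def)
        obtain y where y: "y \<in> U" "\<And>y'. y' \<in> U \<Longrightarrow> \<rho> y \<le> \<rho> y'"
          using ex_min_if_finite[of "\<rho> ` U"] U by (metis (no_types, lifting) arg_min_least arg_min_if_finite(1))
        have yC: "y \<in> C" "\<rho> y > int j" using y by (auto simp: U_def)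
        have "(x, y) \<in> r" "x \<noteq> y" using cmp x yC by auto
        then obtain z where z: "(x, z) \<in> r" "(z, y) \<in> r" "\<rho> z = \<rho> x + 1"
          using step by blast
        have "z \<in> C"
        proof (rule ext)
          show "z \<in> A" using z rA by auto
          fix c assume c: "c \<in> C"
          show "(c, z) \<in> r \<or> (z, c) \<in> r"
          proof (cases "\<rho> c \<le> int j")
            case True
            then have "(c, x) \<in> r" using cmp c x by auto
            then show ?thesis using z tr by (auto dest: transD)
          next
            case False
            then have "(y, c) \<in> r" using cmp c yC y(2)[of c] by (auto simp: U_def)
            then show ?thesis using z tr by (auto dest: transD)
          qed
        qed
        then show "int (Suc j) \<in> \<rho> ` C" using z x by (intro image_eqI[of _ _ z]) auto
      qed
    qed
    have "\<rho> ` C = {0..int k}"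
    proof
      show "\<rho> ` C \<subseteq> {0..int k}" using le lo hi \<rho> CA by fastforce
      show "{0..int k} \<subseteq> \<rho> ` C"
      proof
        fix i assume "i \<in> {0..int k}"
        then show "i \<in> \<rho> ` C" using up[of "nat i"] by auto
      qed
    qed
    then have "card C = k + 1" using card_image[OF inj] by simp
    then show ?thesis using finC by simp
  qed
  have "\<rho> x = 0" if "minimal_in A r x" for x
    using that lo loA \<rho> by (auto simp: minimal_in_def)
  moreover have "\<rho> y = \<rho> x + 1" if "covered_by A r x y" for x y
  proof -
    from that have xy: "(x, y) \<in> r" "x \<noteq> y"
      and cov: "\<And>z. z \<in> A \<Longrightarrow> (x, z) \<in> r \<Longrightarrow> (z, y) \<in> r \<Longrightarrow> z = x \<or> z = y"
      by (auto simp: covered_by_def)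
    obtain z where z: "(x, z) \<in> r" "(z, y) \<in> r" "\<rho> z = \<rho> x + 1" using step xy by blast
    have "z = x \<or> z = y" using cov z rA by blast
    then show ?thesis using z by auto
  qed
  ultimately show ?thesis using po card by (auto simp: graded_of_rank_def rank_function_def)
qed

section \<open>Bruhat order and rank matrices\<close>

definition rk :: "(nat \<Rightarrow> nat) \<Rightarrow> nat \<Rightarrow> nat \<Rightarrow> nat" where
  "rk u i j = card {a \<in> {1..i}. j \<le> u a}"

text \<open>This is the tableau criterion for the Bruhat order, see \<open>bruhat_iff_rk_le\<close>.
  Both indices are unbounded, so that no size enters; \<open>rk_leI\<close> cuts them down to
  \<open>n\<close>.\<close>

definition rk_le :: "(nat \<Rightarrow> nat) \<Rightarrow> (nat \<Rightarrow> nat) \<Rightarrow> bool" where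
  "rk_le u v \<longleftrightarrow> (\<forall>i j. rk u i j \<le> rk v i j)"

lemma rk_0 [simp]: "rk u 0 j = 0"
  by (simp add: rk_def)

lemma rk_Suc: "rk u (Suc i) j = rk u i j + of_bool (j \<le> u (Suc i))"
proof -
  have "{a \<in> {1..Suc i}. j \<le> u a} =
      (if j \<le> u (Suc i) then insert (Suc i) {a \<in> {1..i}. j \<le> u a} else {a \<in> {1..i}. j \<le> u a})"
    by (auto simp: le_Suc_eq)
  then show ?thesis by (simp add: rk_def)
qed

lemma rk_cong: "(\<And>a. 1 \<le> a \<Longrightarrow> a \<le> i \<Longrightarrow> u a = v a) \<Longrightarrow> rk u i j = rk v i j"
  unfolding rk_def by (rule arg_cong[where f = card]) auto

text \<open>The larger letter moves from position \<open>b\<close> to position \<open>a\<close>: the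
  rows gain a letter at \<open>a\<close> and lose the gain again at \<open>b\<close>, and only the
  thresholds between the two letters notice.\<close>

lemma rk_transpose:
  assumes "1 \<le> a" "a < b" "u a < u b"
  shows "rk (u \<circ> transpose a b) i j = rk u i j + of_bool (a \<le> i \<and> i < b \<and> u a < j \<and> j \<le> u b)"
proof (induction i)
  case (Suc i)
  then show ?case using assms by (auto simp: rk_Suc transpose_def)
qed (use assms in simp)

lemma rk_le_refl [simp]: "rk_le u u"
  by (simp add: rk_le_def)

lemma rk_le_trans: "rk_le u v \<Longrightarrow> rk_le v w \<Longrightarrow> rk_le u w"
  unfolding rk_le_def using le_trans by blast

text \<open>The increment between the two rows is the indicator of \<open>j \<le> u (Suc a)\<close>;
  taking the letter itself for \<open>j\<close> recovers it.\<close>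

lemma rk_eq_at:
  assumes "\<And>j. rk u a j = rk v a j" "\<And>j. rk u (Suc a) j = rk v (Suc a) j"
  shows "u (Suc a) = v (Suc a)"
proof (rule antisym)
  show "u (Suc a) \<le> v (Suc a)"
    using assms[of "u (Suc a)"] unfolding rk_Suc by (simp add: of_bool_def split: if_splits)
  show "v (Suc a) \<le> u (Suc a)"
    using assms[of "v (Suc a)"] unfolding rk_Suc by (simp add: of_bool_def split: if_splits)
qed

text \<open>Consecutive rows determine the letters. Position 0 is not counted by \<open>rk\<close>,
  hence its separate hypothesis.\<close>

lemma rk_le_antisym:
  assumes "u 0 = v 0" "rk_le u v" "rk_le v u"
  shows "u = v"
proof
  fix i
  have "rk u i j = rk v i j" for i j using assms by (auto simp: rk_le_def intro: antisym)
  then show "u i = v i" using assms(1) rk_eq_at by (cases i) auto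
qed

lemma permutes_0: "u permutes {1..n} \<Longrightarrow> u 0 = (0::nat)"
  by (rule permutes_not_in) auto

lemma permutes_range: "u permutes {1..n} \<Longrightarrow> 1 \<le> i \<Longrightarrow> i \<le> n \<Longrightarrow> 1 \<le> u i \<and> u i \<le> (n::nat)"
  using permutes_in_image[of u "{1..n}" i] by auto

lemma permutes_pos: "u permutes {1..n} \<Longrightarrow> u i = (0::nat) \<longleftrightarrow> i = 0"
  by (metis permutes_0[of u n] permutes_inj[of u "{1..n}"] injD[of u i 0])

text \<open>A permutation of \<open>{1..n}\<close> also permutes \<open>{1..i}\<close>, so counting
  positions by their letters amounts to counting the letters themselves.\<close>

lemma rk_full:
  assumes "u permutes {1..n}" "n \<le> i"
  shows "rk u i j = card {a \<in> {1..i}. j \<le> a}"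
proof -
  have u: "u permutes {1..i}" by (rule permutes_subset[OF assms(1)]) (use assms(2) in auto)
  have im: "u ` {a \<in> {1..i}. j \<le> u a} = {a \<in> {1..i}. j \<le> a}"
  proof
    show "{a \<in> {1..i}. j \<le> a} \<subseteq> u ` {a \<in> {1..i}. j \<le> u a}"
    proof
      fix a assume a: "a \<in> {a \<in> {1..i}. j \<le> a}"
      have "a \<in> u ` {1..i}" using a permutes_image[OF u] by auto
      then show "a \<in> u ` {a \<in> {1..i}. j \<le> u a}" using a by auto
    qed
  qed (use permutes_in_image[OF u] in auto)
  have "inj_on u {a \<in> {1..i}. j \<le> u a}" using permutes_inj[OF u] inj_on_subset by blast
  from card_image[OF this] show ?thesis unfolding rk_def im by simp
qed

lemma rk_above:
  assumes "u permutes {1..n}" "i \<le> n" "n < j"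
  shows "rk u i j = 0"
proof -
  have "{a \<in> {1..i}. j \<le> u a} = {}" using permutes_range[OF assms(1)] assms by fastforce
  then show ?thesis unfolding rk_def by simp
qed

lemma rk_leI:
  assumes "u permutes {1..n}" "v permutes {1..n}"
    and "\<And>i j. i \<le> n \<Longrightarrow> j \<le> n \<Longrightarrow> rk u i j \<le> rk v i j"
  shows "rk_le u v"
  unfolding rk_le_def
proof (intro allI)
  fix i j
  consider "n \<le> i" | "i \<le> n" "n < j" | "i \<le> n" "j \<le> n" by linarith
  then show "rk u i j \<le> rk v i j"
    using assms by cases (auto simp: rk_full rk_above)
qed

text \<open>Here \<open>a\<close> is the first position where \<open>u\<close> and \<open>v\<close>
  differ and \<open>b\<close> the first later one whose letter in \<open>u\<close> lies above
  \<open>u a\<close> and not above \<open>v a\<close>. The strict inequalities hold on exactly the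
  rectangle where exchanging \<open>a\<close> and \<open>b\<close> raises the rank matrix, so the
  exchange stays below \<open>v\<close>. This serves both the Bruhat order and the permutations of
  blocks.\<close>

lemma rk_le_first_difference:
  assumes u: "u permutes {1..n}" and v: "v permutes {1..n}" and le: "rk_le u v" and ne: "u \<noteq> v"
  obtains a b where "1 \<le> a" "a < b" "b \<le> n" "\<And>c. c < a \<Longrightarrow> u c = v c"
    "u a < u b" "u a < v a" "\<And>c. a < c \<Longrightarrow> c < b \<Longrightarrow> u c < u a \<or> u b < u c"
    "\<And>i j. a \<le> i \<Longrightarrow> i < b \<Longrightarrow> u a < j \<Longrightarrow> j \<le> u b \<Longrightarrow> rk u i j < rk v i j"
proof -
  define a where "a = (LEAST a. u a \<noteq> v a)"
  obtain a0 where "u a0 \<noteq> v a0" using ne by blast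
  then have ua: "u a \<noteq> v a" unfolding a_def by (rule LeastI)
  have lt: "u c = v c" if "c < a" for c using not_less_Least that unfolding a_def by blast
  have a1: "1 \<le> a" using ua permutes_0[OF u] permutes_0[OF v] by (cases a) auto
  have an: "a \<le> n"
    using ua permutes_not_in[OF u, of a] permutes_not_in[OF v, of a] by force
  obtain a' where a': "a = Suc a'" using a1 by (cases a) auto
  have eq: "rk u a' j = rk v a' j" for j by (rule rk_cong) (use lt a' in auto)
  have "rk u a (u a) \<le> rk v a (u a)" using le by (auto simp: rk_le_def)
  then have uva: "u a < v a" using ua eq by (auto simp: a' rk_Suc of_bool_def split: if_splits)
  \<comment> \<open>\<open>P\<close> has a solution: the letter \<open>v a\<close> occurs in
    \<open>u\<close> at some \<open>c\<close>, and not before \<open>a\<close>, where both words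
    agree.\<close>
  define P where "P b \<longleftrightarrow> a < b \<and> u a < u b \<and> u b \<le> v a" for b
  have "v a \<in> {1..n}" using permutes_range[OF v a1 an] by auto
  then have "v a \<in> u ` {1..n}" using permutes_image[OF u] by simp
  then obtain c where c: "c \<in> {1..n}" "u c = v a" by auto
  have "\<not> c < a"
  proof
    assume "c < a"
    then have "v c = v a" using lt c by auto
    then have "c = a" using permutes_inj[OF v] by (auto dest: injD)
    then show False using \<open>c < a\<close> by simp
  qed
  then have Pc: "P c" using c uva unfolding P_def by (cases c a rule: linorder_cases) auto
  define b where "b = (LEAST b. P b)"
  have Pb: "P b" unfolding b_def using Pc by (rule LeastI)
  have bc: "b \<le> c" unfolding b_def using Pc by (rule Least_le)
  have nP: "\<not> P d" if "d < b" for d using not_less_Least that unfolding b_def by blast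
  have gap: "u d < u a \<or> v a < u d" if "a < d" "d < b" for d
  proof -
    have "u d \<noteq> u a" using permutes_inj[OF u] that by (auto dest: injD)
    then show ?thesis using nP[OF that(2)] that by (auto simp: P_def)
  qed
  have strict: "rk u i j < rk v i j" if "a \<le> i" "i < b" "u a < j" "j \<le> u b" for i j
  proof -
    \<comment> \<open>Letters above \<open>v a\<close> are compared by the hypothesis at the
      threshold \<open>?K\<close>. Those from \<open>j\<close> to \<open>v a\<close> occur in
      \<open>u\<close> only before \<open>a\<close>, where \<open>v\<close> agrees; \<open>v\<close>
      has one more of them, at \<open>a\<close> itself.\<close>
    let ?K = "v a + 1"
    have jva: "j \<le> v a" using that Pb by (auto simp: P_def)
    have split: "rk w i j = rk w i ?K + card {c \<in> {1..i}. j \<le> w c \<and> w c \<le> v a}" for w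
    proof -
      have "{c \<in> {1..i}. j \<le> w c} = {c \<in> {1..i}. ?K \<le> w c} \<union> {c \<in> {1..i}. j \<le> w c \<and> w c \<le> v a}"
        using jva by auto
      then show ?thesis unfolding rk_def by (simp, subst card_Un_disjoint) auto
    qed
    have "{c \<in> {1..i}. j \<le> u c \<and> u c \<le> v a} \<subset> {c \<in> {1..i}. j \<le> v c \<and> v c \<le> v a}"
    proof
      show "{c \<in> {1..i}. j \<le> u c \<and> u c \<le> v a} \<subseteq> {c \<in> {1..i}. j \<le> v c \<and> v c \<le> v a}"
      proof
        fix d assume d: "d \<in> {c \<in> {1..i}. j \<le> u c \<and> u c \<le> v a}"
        have "d < a" using gap[of d] d that by (cases d a rule: linorder_cases) auto
        then show "d \<in> {c \<in> {1..i}. j \<le> v c \<and> v c \<le> v a}" using d lt by auto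
      qed
      show "{c \<in> {1..i}. j \<le> u c \<and> u c \<le> v a} \<noteq> {c \<in> {1..i}. j \<le> v c \<and> v c \<le> v a}"
        using that a1 jva by (auto simp: set_eq_iff intro!: exI[of _ a])
    qed
    then have "card {c \<in> {1..i}. j \<le> u c \<and> u c \<le> v a} < card {c \<in> {1..i}. j \<le> v c \<and> v c \<le> v a}"
      by (intro psubset_card_mono) auto
    moreover have "rk u i ?K \<le> rk v i ?K" using le by (auto simp: rk_le_def)
    ultimately show ?thesis using split[of u] split[of v] by linarith
  qed
  show thesis
  proof (rule that[of a b])
    show "u c < u a \<or> u b < u c" if "a < c" "c < b" for c
      using gap[OF that] Pb by (auto simp: P_def)
  qed (use a1 Pb bc c lt uva strict in \<open>auto simp: P_def\<close>)
qed

section \<open>Lengths under transpositions and the rank criterion for the Bruhat order\<close>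

text \<open>The pair \<open>(a, b)\<close> is a new inversion, and the old inversions embed into the
  remaining ones. If no intermediate position carries an intermediate letter, the embedding is
  onto.\<close>

lemma perm_length_transpose:
  assumes u: "u permutes {1..n}" and ab: "1 \<le> a" "a < b" "b \<le> n" "u a < u b"
  shows "perm_length n u < perm_length n (u \<circ> transpose a b)"
    and "(\<And>c. a < c \<Longrightarrow> c < b \<Longrightarrow> u c < u a \<or> u b < u c) \<Longrightarrow>
      perm_length n (u \<circ> transpose a b) = Suc (perm_length n u)"
proof -
  let ?t = "transpose a b"
  define Inv where "Inv w = {(i, j). i \<in> {1..n} \<and> j \<in> {1..n} \<and> i < j \<and> w i > w j}"
    for w :: "nat \<Rightarrow> nat"
  define \<phi> where "\<phi> = (\<lambda>(i, j). if ?t i < ?t j then (?t i, ?t j) else (i, j))"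
  have fin: "finite (Inv w)" for w
    by (rule finite_subset[of _ "{1..n} \<times> {1..n}"]) (auto simp: Inv_def)
  \<comment> \<open>\<open>\<phi>\<close> is an involution on increasing pairs; it sends the inversions of \<open>u\<close> to inversions of
    \<open>u \<circ> ?t\<close> other than \<open>(a, b)\<close>, and onto all of those when the transposition is a cover.\<close>
  have invol: "\<phi> (\<phi> (i, j)) = (i, j)" if "i < j" for i j
    using that by (simp add: \<phi>_def)
  have inj: "inj_on \<phi> (Inv u)"
    by (rule inj_on_inverseI[where g = \<phi>]) (use invol in \<open>auto simp: Inv_def\<close>)
  \<comment> \<open>The increasing pairs whose order \<open>?t\<close> reverses; on these
    \<open>\<phi>\<close> is the identity.\<close>
  have rev: "(i = a \<and> j = b) \<or> (i = a \<and> a < j \<and> j < b) \<or> (a < i \<and> i < b \<and> j = b)"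
    if "i < j" "\<not> ?t i < ?t j" for i j
    using that ab(2) unfolding transpose_def by (auto split: if_splits)
  have t_range: "1 \<le> ?t i \<and> ?t i \<le> n" if "1 \<le> i" "i \<le> n" for i
    using that ab by (simp add: transpose_def)
  have sub: "\<phi> ` Inv u \<subseteq> Inv (u \<circ> ?t) - {(a, b)}"
  proof
    fix x assume "x \<in> \<phi> ` Inv u"
    then obtain i j where x: "x = \<phi> (i, j)" and h: "1 \<le> i" "i \<le> n" "1 \<le> j" "j \<le> n" "i < j" "u j < u i"
      by (auto simp: Inv_def)
    show "x \<in> Inv (u \<circ> ?t) - {(a, b)}"
    proof (cases "?t i < ?t j")
      case True
      then have "(?t i, ?t j) \<noteq> (a, b)"
        using h ab(2) by (metis Pair_inject less_asym transpose_apply_first transpose_apply_second transpose_involutory)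
      then show ?thesis using True h t_range by (simp add: x \<phi>_def Inv_def)
    next
      case False
      then show ?thesis using rev[OF h(5) False] h ab
        by (auto simp: x \<phi>_def Inv_def transpose_def)
    qed
  qed
  have mem: "(a, b) \<in> Inv (u \<circ> ?t)"
    using ab by (auto simp: Inv_def)
  have len: "perm_length n w = card (Inv w)" for w by (simp add: perm_length_def Inv_def)
  have "card (Inv u) \<le> card (Inv (u \<circ> ?t) - {(a, b)})"
    using card_inj_on_le[OF inj sub] fin by simp
  also have "\<dots> < card (Inv (u \<circ> ?t))" using mem fin by (rule card_Diff1_less[rotated])
  finally show "perm_length n u < perm_length n (u \<circ> ?t)" by (simp add: len)
  assume gap: "\<And>c. a < c \<Longrightarrow> c < b \<Longrightarrow> u c < u a \<or> u b < u c"
  have "Inv (u \<circ> ?t) - {(a, b)} \<subseteq> \<phi> ` Inv u"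
  proof
    fix x assume x: "x \<in> Inv (u \<circ> ?t) - {(a, b)}"
    obtain i j where ij: "x = (i, j)" by (cases x)
    have h: "1 \<le> i" "j \<le> n" "i < j" "u (?t j) < u (?t i)" "\<not> (i = a \<and> j = b)"
      using x by (auto simp: Inv_def ij)
    show "x \<in> \<phi> ` Inv u"
    proof (cases "?t i < ?t j")
      case True
      have "(?t i, ?t j) \<in> Inv u" using True h t_range by (simp add: Inv_def)
      moreover have "\<phi> (?t i, ?t j) = (i, j)" using h by (simp add: \<phi>_def)
      ultimately show ?thesis unfolding ij by force
    next
      case False
      then have "(i = a \<and> a < j \<and> j < b) \<or> (a < i \<and> i < b \<and> j = b)"
        using rev h by blast
      then have "u j < u i" using h gap[of i] gap[of j] by (auto simp: transpose_def split: if_splits)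
      then have "(i, j) \<in> Inv u" using h by (auto simp: Inv_def)
      moreover have "\<phi> (i, j) = (i, j)" using False by (simp add: \<phi>_def)
      ultimately show ?thesis unfolding ij by force
    qed
  qed
  with sub have "card (Inv (u \<circ> ?t) - {(a, b)}) = card (Inv u)"
    using card_image[OF inj] by (metis subset_antisym)
  then show "perm_length n (u \<circ> ?t) = Suc (perm_length n u)"
    using card_Suc_Diff1[OF fin mem] unfolding len by linarith
qed

lemma perm_length_le: "perm_length n u \<le> n * n"
proof -
  have "perm_length n u \<le> card ({1..n} \<times> {1..n})"
    unfolding perm_length_def by (rule card_mono) auto
  then show ?thesis by simp
qed

text \<open>A transposition that lengthens \<open>u\<close> must move the larger letter to the left,
  and \<open>rk_transpose\<close> says that this raises the rank matrix.\<close>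

lemma bruhat_step_rk_le:
  assumes "(u, v) \<in> bruhat_step n"
  shows "rk_le u v"
proof -
  obtain a b where u: "u permutes {1..n}" and ab: "1 \<le> a" "a < b" "b \<le> n"
    and v: "v = u \<circ> transpose a b" and len: "perm_length n u < perm_length n v"
  proof -
    obtain a b where "u permutes {1..n}" "a \<in> {1..n}" "b \<in> {1..n}" "a \<noteq> b"
      "v = u \<circ> transpose a b" "perm_length n u < perm_length n v"
      using assms by (auto simp: bruhat_step_def sym_group_def)
    then show thesis
      using that[of a b] that[of b a] by (cases a b rule: linorder_cases) (auto simp: transpose_commute)
  qed
  have "u a < u b"
  \<comment> \<open>Otherwise the letters would increase in \<open>v\<close>, and transposing back
    to \<open>u\<close> would lengthen as well.\<close>
  proof (rule ccontr)
    assume "\<not> u a < u b"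
    moreover have "u a \<noteq> u b" using permutes_inj[OF u] ab by (auto dest: injD)
    ultimately have "v a < v b" by (simp add: v)
    moreover have "v permutes {1..n}"
      unfolding v by (intro permutes_compose permutes_swap_id u) (use ab in auto)
    ultimately have "perm_length n v < perm_length n (v \<circ> transpose a b)"
      using perm_length_transpose(1)[of v n a b] ab by auto
    then show False using len by (simp add: v comp_assoc)
  qed
  then show ?thesis using rk_transpose[of a b u] ab by (simp add: rk_le_def v)
qed

text \<open>The exchange found by \<open>rk_le_first_difference\<close> is a Bruhat step that stays
  below \<open>v\<close>. Lengths are bounded by \<open>n * n\<close>, so the process ends.\<close>

lemma rk_le_imp_bruhat_steps:
  assumes "u permutes {1..n}" "v permutes {1..n}" "rk_le u v"
  shows "(u, v) \<in> (bruhat_step n)\<^sup>*"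
  using assms
proof (induction "n * n - perm_length n u" arbitrary: u rule: less_induct)
  case less
  show ?case
  proof (cases "u = v")
    case False
    obtain a b where ab: "1 \<le> a" "a < b" "b \<le> n" "u a < u b"
      and strict: "\<And>i j. a \<le> i \<Longrightarrow> i < b \<Longrightarrow> u a < j \<Longrightarrow> j \<le> u b \<Longrightarrow> rk u i j < rk v i j"
      using rk_le_first_difference[OF less.prems False] by metis
    let ?w = "u \<circ> transpose a b"
    have w: "?w permutes {1..n}"
      by (intro permutes_compose permutes_swap_id less.prems) (use ab in auto)
    have len: "perm_length n u < perm_length n ?w"
      using perm_length_transpose(1)[OF less.prems(1) ab] .
    \<comment> \<open>The rank matrix grows by one only on the rectangle where \<open>strict\<close>
      provides room for it.\<close>
    have "rk ?w i j \<le> rk v i j" for i j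
      using strict[of i j] less.prems(3) 
      by (simp add: rk_transpose[OF ab(1,2,4)] rk_le_def of_bool_def Suc_le_eq)
    then have "rk_le ?w v" by (simp add: rk_le_def)
    moreover have "n * n - perm_length n ?w < n * n - perm_length n u"
      using len perm_length_le[of n ?w] by linarith
    ultimately have "(?w, v) \<in> (bruhat_step n)\<^sup>*" using less.hyps w less.prems by blast
    moreover have "(u, ?w) \<in> bruhat_step n"
      using less.prems ab len 
      unfolding bruhat_step_def sym_group_def
      by (intro CollectI case_prodI conjI bexI[of _ a] bexI[of _ b]) auto
    ultimately show ?thesis by (rule converse_rtrancl_into_rtrancl[rotated])
  qed auto
qed

text \<open>From here on the Bruhat order is handled through rank matrices alone.\<close>

theorem bruhat_iff_rk_le:
  "(u, v) \<in> bruhat n \<longleftrightarrow> u permutes {1..n} \<and> v permutes {1..n} \<and> rk_le u v"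
proof -
  have "rk_le u v" if "(u, v) \<in> (bruhat_step n)\<^sup>*"
    using that by induction (auto intro: rk_le_trans bruhat_step_rk_le)
  then show ?thesis
    using rk_le_imp_bruhat_steps by (auto simp: bruhat_def sym_group_def)
qed

lemma wachs_permutes: "v \<in> wachs n \<Longrightarrow> v permutes {1..n}"
  by (simp add: wachs_def sym_group_def)

lemma wachs_order_iff:
  "(u, v) \<in> wachs_order n \<longleftrightarrow> u \<in> wachs n \<and> v \<in> wachs n \<and> rk_le u v"
  using wachs_permutes by (auto simp: wachs_order_def bruhat_iff_rk_le)

lemma partial_order_wachs: "partial_order_on (wachs n) (wachs_order n)"
  unfolding partial_order_on_def preorder_on_def
proof (intro conjI)
  show "refl_on (wachs n) (wachs_order n)" by (auto simp: refl_on_def wachs_order_iff)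
  show "trans (wachs_order n)" by (auto simp: trans_def wachs_order_iff intro: rk_le_trans)
  show "antisym (wachs_order n)"
    by (rule antisymI) (auto simp: wachs_order_iff dest!: wachs_permutes permutes_0 intro: rk_le_antisym)
qed (auto simp: wachs_order_iff)

section \<open>The least and the greatest permutation\<close>

text \<open>At most \<open>j - 1\<close> of the first \<open>i\<close> letters lie below
  \<open>j\<close>; the identity attains the resulting lower bound on the rank matrix.\<close>

lemma rk_le_bot:
  assumes v: "v permutes {1..n}"
  shows "rk_le id v"
proof (rule rk_leI[OF permutes_id v])
  fix i j assume ij: "i \<le> n" "j \<le> n"
  have "inj_on v {a \<in> {1..i}. v a < j}" using permutes_inj[OF v] inj_on_subset by blast
  moreover have "v ` {a \<in> {1..i}. v a < j} \<subseteq> {1..<j}"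
    using permutes_range[OF v] ij by force
  ultimately have "card {a \<in> {1..i}. v a < j} \<le> j - 1"
    using card_inj_on_le[of v _ "{1..<j}"] by auto
  moreover have "card {1..i} = rk v i j + card {a \<in> {1..i}. v a < j}"
  proof -
    have "{1..i} = {a \<in> {1..i}. j \<le> v a} \<union> {a \<in> {1..i}. v a < j}" by auto
    then show ?thesis unfolding rk_def by (metis (no_types, lifting) card_Un_disjoint finite_Un finite_atLeastAtMost disjoint_iff mem_Collect_eq not_less)
  qed
  moreover have "rk id i j \<le> i - (j - 1)"
  proof -
    have "{a \<in> {1..i}. j \<le> id a} = {max 1 j..i}" by auto
    then show ?thesis by (simp add: rk_def)
  qed
  ultimately show "rk id i j \<le> rk v i j" by simp
qed

definition longest :: "nat \<Rightarrow> nat \<Rightarrow> nat" where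
  "longest n i = (if i \<in> {1..n} then n + 1 - i else i)"

lemma longest_permutes: "longest n permutes {1..n}"
  by (rule bij_imp_permutes)
    (auto simp: longest_def intro!: bij_betwI[where g = "longest n"])

text \<open>An entry of the rank matrix is bounded by the number \<open>i\<close> of positions and
  by the number of letters in \<open>{j..n}\<close>; the reversed word attains the minimum of
  both.\<close>

lemma rk_le_top:
  assumes v: "v permutes {1..n}"
  shows "rk_le v (longest n)"
proof (rule rk_leI[OF v longest_permutes])
  fix i j assume ij: "i \<le> n" "j \<le> n"
  have "{a \<in> {1..i}. j \<le> longest n a} = {1..min i (n + 1 - j)}"
    using ij by (auto simp: longest_def)
  then have "rk (longest n) i j = min i (n + 1 - j)" by (simp add: rk_def)
  moreover have "rk v i j \<le> i" unfolding rk_def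

    by (rule order_trans[OF card_mono[of "{1..i}"]]) auto
  moreover have "rk v i j \<le> card {j..n}" unfolding rk_def
    by (rule card_inj_on_le[of v])
      (use permutes_inj[OF v] permutes_range[OF v] ij in \<open>auto intro: inj_on_subset\<close>)
  ultimately show "rk v i j \<le> rk (longest n) i j" by simp
qed

lemma perm_length_longest: "perm_length n (longest n) = n choose 2"
proof -
  have "perm_length n (longest n) = card {(i, j). i \<in> {1..n} \<and> j \<in> {1..n} \<and> i < j}"
    unfolding perm_length_def by (rule arg_cong[where f = card]) (auto simp: longest_def)
  also have "\<dots> = n choose 2"
  proof (induction n)
    case (Suc n)
    have "{(i, j). i \<in> {1..Suc n} \<and> j \<in> {1..Suc n} \<and> i < j} =
        {(i, j). i \<in> {1..n} \<and> j \<in> {1..n} \<and> i < j} \<union> {1..n} \<times> {Suc n}" by auto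
    moreover have "card \<dots> = (n choose 2) + n"
      by (subst card_Un_disjoint)
        (auto simp: Suc.IH[symmetric] card_cartesian_product
          intro: finite_subset[of _ "{1..n} \<times> {1..n}"])
    ultimately show ?case by (simp add: numeral_2_eq_2)
  qed simp
  finally show ?thesis .
qed

lemma perm_length_id: "perm_length n id = 0"
proof -
  have "{(i, j). i \<in> {1..n} \<and> j \<in> {1..n} \<and> i < j \<and> id i > id j} = {}" by auto
  then show ?thesis unfolding perm_length_def by (metis card.empty)
qed

section \<open>The block structure of Wachs permutations\<close>

lemma inj_permutesI:
  fixes u :: "nat \<Rightarrow> nat"
  assumes "inj_on u {1..n}" "\<And>i. 1 \<le> i \<Longrightarrow> i \<le> n \<Longrightarrow> 1 \<le> u i \<and> u i \<le> n"
    and "\<And>i. i \<notin> {1..n} \<Longrightarrow> u i = i"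
  shows "u permutes {1..n}"
proof (rule bij_imp_permutes)
  have "u ` {1..n} \<subseteq> {1..n}" using assms(2) by auto
  then have "u ` {1..n} = {1..n}" using assms(1) by (intro endo_inj_surj) auto
  then show "bij_betw u {1..n} {1..n}" using assms(1) by (simp add: bij_betw_def)
qed (use assms in auto)

abbreviation block :: "nat \<Rightarrow> nat" where
  "block i \<equiv> (i + 1) div 2"

text \<open>\<open>star n\<close> exchanges the two letters of a block, so the Wachs condition says
  that they stand in neighbouring positions. The right side is symmetric in \<open>a\<close> and
  \<open>b\<close>, hence the one-sided bound. For odd \<open>n\<close> the letter \<open>n\<close>
  is alone in its block.\<close>

lemma wachs_iff:
  "v \<in> wachs n \<longleftrightarrow> v permutes {1..n} \<and>
    (\<forall>a\<in>{1..n}. \<forall>b\<in>{1..n}. block (v a) = block (v b) \<longrightarrow> a \<le> b + 1)"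
proof (cases "v permutes {1..n}")
  case v: True
  have inv_eq: "inv v (v a) = a" for a using permutes_inverses[OF v] by simp
  have inv_eq': "v (inv v a) = a" for a using permutes_inverses[OF v] by simp
  have inv_range: "inv v i \<in> {1..n}" if "i \<in> {1..n}" for i
    using permutes_in_image[OF permutes_inv[OF v]] that by blast
  show ?thesis
  proof
    assume w: "v \<in> wachs n"
    have "a \<le> b + 1" if ab: "a \<in> {1..n}" "b \<in> {1..n}" "block (v a) = block (v b)" for a b
    proof -
      have range: "v a \<in> {1..n}" "v b \<in> {1..n}" using permutes_in_image[OF v] ab by blast+
      have close: "\<bar>int (inv v i) - int (inv v (star n i))\<bar> \<le> 1" if "i \<in> {1..n - 1}" for i
        using w that by (simp add: wachs_def)
      consider "v a = v b" | "v a < v b" | "v b < v a" by linarith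
      then show ?thesis
      proof cases
        case 1
        then show ?thesis using inv_eq by (metis le_add1)
      next
        case 2
        \<comment> \<open>The condition in \<open>wachs\<close> omits the letter \<open>n\<close>,
          so it is applied to the smaller letter of the block.\<close>
        then have "v a \<in> {1..n - 1}" "star n (v a) = v b"
          using ab(3) range by (auto simp: star_def elim!: oddE evenE)
        then show ?thesis using close[of "v a"] by (simp add: inv_eq)
      next
        case 3
        then have "v b \<in> {1..n - 1}" "star n (v b) = v a"
          using ab(3) range by (auto simp: star_def elim!: oddE evenE)
        then show ?thesis using close[of "v b"] by (simp add: inv_eq)
      qed
    qed
    then show "v permutes {1..n} \<and>
      (\<forall>a\<in>{1..n}. \<forall>b\<in>{1..n}. block (v a) = block (v b) \<longrightarrow> a \<le> b + 1)" using v by blast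
  next
    assume R: "v permutes {1..n} \<and>
      (\<forall>a\<in>{1..n}. \<forall>b\<in>{1..n}. block (v a) = block (v b) \<longrightarrow> a \<le> b + 1)"
    have "\<bar>int (inv v i) - int (inv v (star n i))\<bar> \<le> 1" if i: "i \<in> {1..n - 1}" for i
    proof -
      have s: "star n i \<in> {1..n}" "block (star n i) = block i"
        using i by (auto simp: star_def elim!: oddE evenE)
      have "inv v i \<in> {1..n}" "inv v (star n i) \<in> {1..n}"
        by (rule inv_range; use s i in force)+
      moreover have "block (v (inv v i)) = block (v (inv v (star n i)))"
        using s by (simp add: inv_eq')
      ultimately have "inv v i \<le> inv v (star n i) + 1" "inv v (star n i) \<le> inv v i + 1"
        using R by metis+
      then show ?thesis by linarith
    qed
    then show "v \<in> wachs n" using v by (simp add: wachs_def sym_group_def)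
  qed
qed (simp add: wachs_def sym_group_def)

lemma finite_wachs: "finite (wachs n)"
  by (rule finite_subset[of _ "{p. p permutes {1..n}}"])
    (auto simp: wachs_def sym_group_def finite_permutations)

text \<open>
  \<open>paired \<tau> E\<close> has the letters \<open>2 \<tau>(k) - 1\<close> and \<open>2 \<tau>(k)\<close> in the positions \<open>2 k - 1\<close> and \<open>2 k\<close>,
  in descending order if \<open>k \<in> E\<close> and in ascending order otherwise.
\<close>

definition paired :: "(nat \<Rightarrow> nat) \<Rightarrow> nat set \<Rightarrow> nat \<Rightarrow> nat" where
  "paired \<tau> E i = (if even i then 2 * \<tau> (i div 2) - of_bool (i div 2 \<in> E)
     else 2 * \<tau> (block i) - 1 + of_bool (block i \<in> E))"

lemma paired_even: "paired \<tau> E (2 * k) = 2 * \<tau> k - of_bool (k \<in> E)"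
  by (simp add: paired_def)

lemma paired_odd: "paired \<tau> E (Suc (2 * k)) = 2 * \<tau> (Suc k) - 1 + of_bool (Suc k \<in> E)"
  by (simp add: paired_def)

lemma nat_even_odd_cases:
  obtains k where "i = 2 * k" | k where "i = Suc (2 * k)"
  by (metis evenE oddE Suc_eq_plus1)

lemma block_simps [simp]: "block (2 * k) = k" "block (Suc (2 * k)) = Suc k"
  by auto

lemma perm_length_sum:
  "perm_length n u = (\<Sum>i\<in>{1..n}. \<Sum>j\<in>{1..n}. of_bool (i < j \<and> u j < u i))"
proof -
  have "perm_length n u = (\<Sum>p\<in>{1..n} \<times> {1..n}. of_bool (fst p < snd p \<and> u (snd p) < u (fst p)))"
    unfolding perm_length_def
    by (subst sum_of_bool_eq) (auto intro!: arg_cong[where f = card])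
  then show ?thesis by (simp only: sum.cartesian_product split_def)
qed

lemma sum_pairs: "(\<Sum>i\<in>{1..2 * m}. g i) = (\<Sum>k\<in>{1..m}. g (2 * k - 1) + g (2 * k))"
  for g :: "nat \<Rightarrow> nat"
  by (induction m) (auto simp: add.assoc)

context
  fixes m :: nat and \<tau> :: "nat \<Rightarrow> nat" and E :: "nat set"
  assumes \<tau>: "\<tau> permutes {1..m}" and E: "E \<subseteq> {1..m}"
begin

text \<open>Ensures that the subtractions in \<open>paired\<close> are not truncated.\<close>

lemma tau_pos: "1 \<le> \<tau> (Suc k)"
  using permutes_pos[OF \<tau>, of "Suc k"] by simp

lemma block_paired: "block (paired \<tau> E i) = \<tau> (block i)"
proof (cases i rule: nat_even_odd_cases)
  case (1 k)
  have "k = 0 \<or> 1 \<le> \<tau> k" using tau_pos by (cases k) auto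
  moreover have "0 \<notin> E" using E by auto
  ultimately show ?thesis using permutes_0[OF \<tau>] unfolding 1 paired_even block_simps
    by (auto simp: of_bool_def)
next
  case (2 k)
  show ?thesis using tau_pos[of k] unfolding 2 paired_odd block_simps
    by (auto simp: of_bool_def)
qed

lemma paired_permutes: "paired \<tau> E permutes {1..2 * m}"
proof (rule inj_permutesI)
  show "inj_on (paired \<tau> E) {1..2 * m}"
  proof (rule inj_onI)
    fix i j assume i: "i \<in> {1..2 * m}" and j: "j \<in> {1..2 * m}" and eq: "paired \<tau> E i = paired \<tau> E j"
    then have "\<tau> (block i) = \<tau> (block j)" using block_paired by metis
    then have b: "block i = block j" using permutes_inj[OF \<tau>] by (auto dest: injD)
    show "i = j"
    proof (rule ccontr)
      assume "i \<noteq> j"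
      then obtain k where "{i, j} = {Suc (2 * k), 2 * Suc k}"
        using b i j by (cases i rule: nat_even_odd_cases; cases j rule: nat_even_odd_cases) auto
      then have "paired \<tau> E (2 * Suc k) = paired \<tau> E (Suc (2 * k))"
        using eq by (auto simp: doubleton_eq_iff)
      then show False using tau_pos[of k] unfolding paired_even paired_odd
        by (auto simp: of_bool_def split: if_splits)
    qed
  qed
  show "1 \<le> paired \<tau> E i \<and> paired \<tau> E i \<le> 2 * m" if "1 \<le> i" "i \<le> 2 * m" for i
  proof -
    have "1 \<le> \<tau> (block i) \<and> \<tau> (block i) \<le> m" using permutes_range[OF \<tau>, of "block i"] that by auto
    then show ?thesis using block_paired[of i] by auto
  qed
  show "paired \<tau> E i = i" if "i \<notin> {1..2 * m}" for i
  proof (cases i rule: nat_even_odd_cases)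
    case (1 k)
    then have "k \<notin> {1..m}" using that by auto
    then show ?thesis using permutes_not_in[OF \<tau>] E unfolding 1 paired_even by auto
  next
    case (2 k)
    then have "Suc k \<notin> {1..m}" using that by auto
    then show ?thesis using permutes_not_in[OF \<tau>] E unfolding 2 paired_odd by auto
  qed
qed

lemma paired_wachs: "paired \<tau> E \<in> wachs (2 * m)"
  unfolding wachs_iff
proof (intro conjI ballI impI paired_permutes)
  fix a b assume "block (paired \<tau> E a) = block (paired \<tau> E b)"
  then have "\<tau> (block a) = \<tau> (block b)" by (simp only: block_paired)
  then have "block a = block b" using permutes_inj[OF \<tau>] by (auto dest: injD)
  then show "a \<le> b + 1" by linarith
qed

lemma f_even_paired: "f_even m (paired \<tau> E) = \<tau>"
  unfolding f_even_def
proof (rule the_equality)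
  have set: "{paired \<tau> E (2 * i - 1), paired \<tau> E (2 * i)} = {2 * \<tau> i - 1, 2 * \<tau> i}" if i: "i \<in> {1..m}" for i
  proof -
    obtain k where k: "i = Suc k" using i by (cases i) auto
    have "2 * i - 1 = Suc (2 * k)" by (simp add: k)
    then show ?thesis using tau_pos[of k] unfolding paired_even
      by (simp only: paired_odd k) (auto simp: of_bool_def)
  qed
  then show "\<tau> \<in> sym_group m \<and>
      (\<forall>i\<in>{1..m}. {paired \<tau> E (2 * i - 1), paired \<tau> E (2 * i)} = {2 * \<tau> i - 1, 2 * \<tau> i})"
    using \<tau> by (simp add: sym_group_def)
  fix \<sigma> assume \<sigma>: "\<sigma> \<in> sym_group m \<and>
      (\<forall>i\<in>{1..m}. {paired \<tau> E (2 * i - 1), paired \<tau> E (2 * i)} = {2 * \<sigma> i - 1, 2 * \<sigma> i})"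
  show "\<sigma> = \<tau>"
  proof
    fix i
    show "\<sigma> i = \<tau> i"
    proof (cases "i \<in> {1..m}")
      case True
      then have "{2 * \<sigma> i - 1, 2 * \<sigma> i} = {2 * \<tau> i - 1, 2 * \<tau> i}" using \<sigma> set by metis
      then show ?thesis unfolding doubleton_eq_iff by presburger
    next
      case False
      then show ?thesis
        using \<sigma> permutes_not_in[OF \<tau>] permutes_not_in[of \<sigma> "{1..m}"] by (auto simp: sym_group_def)
    qed
  qed
qed

text \<open>An even row ends with a complete block of positions, and an odd column starts with a
  complete block of letters. Only where both blocks are cut in the middle, at an odd row and an even
  column, can the set \<open>E\<close> be seen.\<close>

lemma rk_paired:
  "rk (paired \<tau> E) (2 * k) (Suc (2 * l)) = 2 * rk \<tau> k (Suc l)"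
  "rk (paired \<tau> E) (2 * k) (2 * l) = rk \<tau> k l + rk \<tau> k (Suc l)"
  "rk (paired \<tau> E) (Suc (2 * k)) (Suc (2 * l)) = rk \<tau> k (Suc l) + rk \<tau> (Suc k) (Suc l)"
  "rk (paired \<tau> E) (Suc (2 * k)) (2 * l) =
    rk \<tau> k l + rk \<tau> (Suc k) (Suc l) + of_bool (\<tau> (Suc k) = l \<and> Suc k \<in> E)"
proof -
  have rec: "rk u (2 * Suc k) j = rk u (2 * k) j + of_bool (j \<le> u (Suc (2 * k))) + of_bool (j \<le> u (2 * Suc k))"
    for u k j by (simp add: rk_Suc)
  show A: "rk (paired \<tau> E) (2 * k) (Suc (2 * l)) = 2 * rk \<tau> k (Suc l)" for k l
  proof (induction k)
    case (Suc k)
    show ?case using tau_pos[of k] unfolding rec Suc paired_even paired_odd rk_Suc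
      by (auto simp: of_bool_def; presburger)
  qed simp
  show B: "rk (paired \<tau> E) (2 * k) (2 * l) = rk \<tau> k l + rk \<tau> k (Suc l)" for k l
  proof (induction k)
    case (Suc k)
    show ?case using tau_pos[of k] unfolding rec Suc paired_even paired_odd rk_Suc
      by (auto simp: of_bool_def; presburger)
  qed simp
  show "rk (paired \<tau> E) (Suc (2 * k)) (Suc (2 * l)) = rk \<tau> k (Suc l) + rk \<tau> (Suc k) (Suc l)"
    using tau_pos[of k] unfolding rk_Suc A paired_odd by (auto simp: of_bool_def; presburger)
  show "rk (paired \<tau> E) (Suc (2 * k)) (2 * l) =
    rk \<tau> k l + rk \<tau> (Suc k) (Suc l) + of_bool (\<tau> (Suc k) = l \<and> Suc k \<in> E)"
    using tau_pos[of k] unfolding rk_Suc B paired_odd by (auto simp: of_bool_def; presburger)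
qed

text \<open>An inversion of \<open>\<tau>\<close> inverts all four pairs of letters from its two
  blocks, and a descending block contributes one inversion inside itself.\<close>

lemma perm_length_paired: "perm_length (2 * m) (paired \<tau> E) = 4 * perm_length m \<tau> + card E"
proof -
  let ?v = "paired \<tau> E"
  let ?I = "\<lambda>i j. of_bool (i < j \<and> ?v j < ?v i) :: nat"
  \<comment> \<open>The contribution of the positions in block \<open>k\<close> against those in
    block \<open>l\<close>.\<close>
  have cell: "?I (2 * k - 1) (2 * l - 1) + ?I (2 * k - 1) (2 * l) + (?I (2 * k) (2 * l - 1) + ?I (2 * k) (2 * l))
      = 4 * of_bool (k < l \<and> \<tau> l < \<tau> k) + of_bool (k = l \<and> k \<in> E)"
    if kl: "k \<in> {1..m}" "l \<in> {1..m}" for k l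
  proof -
    obtain k' l' where k: "k = Suc k'" and l: "l = Suc l'" using kl by (cases k; cases l) auto
    have s: "2 * k - 1 = Suc (2 * k')" "2 * l - 1 = Suc (2 * l')" by (simp_all add: k l)
    have v: "?v (2 * k - 1) = 2 * \<tau> k - 1 + of_bool (k \<in> E)" "?v (2 * l - 1) = 2 * \<tau> l - 1 + of_bool (l \<in> E)"
      unfolding s paired_odd by (simp_all add: k l)
    have p: "1 \<le> \<tau> k" "1 \<le> \<tau> l" "1 \<le> k" "1 \<le> l" using tau_pos by (auto simp: k l)
    have inj: "\<tau> k = \<tau> l \<longleftrightarrow> k = l" using permutes_inj[OF \<tau>] by (auto dest: injD)
    have bound: "i \<in> {2 * k - 1, 2 * k} \<Longrightarrow> 2 * \<tau> k \<le> ?v i + 1 \<and> ?v i \<le> 2 * \<tau> k"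
      "j \<in> {2 * l - 1, 2 * l} \<Longrightarrow> 2 * \<tau> l \<le> ?v j + 1 \<and> ?v j \<le> 2 * \<tau> l" for i j
      using p v paired_even[of \<tau> E k] paired_even[of \<tau> E l] by (auto simp: of_bool_def)
    consider "k = l" | "k < l" "\<tau> k < \<tau> l" | "k < l" "\<tau> l < \<tau> k" | "l < k"
      using inj by (metis linorder_neqE_nat)
    then show ?thesis
    proof cases
      case 1
      then show ?thesis using p v paired_even[of \<tau> E k] by (cases "k \<in> E") auto
    next
      case 2
      then have "?v i < ?v j" if "i \<in> {2 * k - 1, 2 * k}" "j \<in> {2 * l - 1, 2 * l}" for i j
        using bound(1)[OF that(1)] bound(2)[OF that(2)] by linarith
      then have "\<not> ?v j < ?v i" if "i \<in> {2 * k - 1, 2 * k}" "j \<in> {2 * l - 1, 2 * l}" for i j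
        using that less_asym by blast
      then show ?thesis using 2 by simp
    next
      case 3
      then have "?v j < ?v i" if "i \<in> {2 * k - 1, 2 * k}" "j \<in> {2 * l - 1, 2 * l}" for i j
        using bound(1)[OF that(1)] bound(2)[OF that(2)] by linarith
      moreover have "2 * k - 1 < 2 * l - 1" "2 * k - 1 < 2 * l" "2 * k < 2 * l - 1" "2 * k < 2 * l"
        using 3 p by linarith+
      ultimately show ?thesis using 3 by simp
    next
      case 4
      then have "\<not> 2 * k - 1 < 2 * l - 1" "\<not> 2 * k - 1 < 2 * l" "\<not> 2 * k < 2 * l - 1" "\<not> 2 * k < 2 * l"
        using p by linarith+
      then show ?thesis using 4 by simp
    qed
  qed
  have "perm_length (2 * m) ?v = (\<Sum>k\<in>{1..m}. \<Sum>l\<in>{1..m}.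
      (?I (2 * k - 1) (2 * l - 1) + ?I (2 * k - 1) (2 * l) + (?I (2 * k) (2 * l - 1) + ?I (2 * k) (2 * l))))"
    by (simp only: perm_length_sum sum_pairs sum.distrib)
  also have "\<dots> = (\<Sum>k\<in>{1..m}. \<Sum>l\<in>{1..m}. 4 * of_bool (k < l \<and> \<tau> l < \<tau> k) + of_bool (k = l \<and> k \<in> E))"
    by (intro sum.cong refl cell)
  also have "\<dots> = 4 * perm_length m \<tau> + (\<Sum>k\<in>{1..m}. \<Sum>l\<in>{1..m}. of_bool (k = l \<and> k \<in> E))"
    by (simp only: perm_length_sum sum.distrib sum_distrib_left)
  also have "(\<Sum>k\<in>{1..m}. \<Sum>l\<in>{1..m}. of_bool (k = l \<and> k \<in> E)) = (\<Sum>k\<in>{1..m}. of_bool (k \<in> E) :: nat)"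
  proof (intro sum.cong refl)
    fix k assume k: "k \<in> {1..m}"
    have "(\<Sum>l\<in>{1..m}. of_bool (k = l \<and> k \<in> E)) =
        (\<Sum>l\<in>{1..m}. if k = l then of_bool (k \<in> E) else 0 :: nat)"
      by (intro sum.cong) auto
    then show "(\<Sum>l\<in>{1..m}. of_bool (k = l \<and> k \<in> E)) = (of_bool (k \<in> E) :: nat)"
      using k by (simp only: sum.delta' finite_atLeastAtMost if_True)
  qed
  also have "\<dots> = card E"
  proof -
    have "{1..m} \<inter> {k. k \<in> E} = E" using E by auto
    then show ?thesis by (simp only: sum_of_bool_eq finite_atLeastAtMost) simp
  qed
  finally show ?thesis .
qed

lemma wachs_length_paired: "wachs_length (2 * m) (paired \<tau> E) = int (3 * perm_length m \<tau> + card E)"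
  by (simp add: wachs_length_def f_wachs_def f_even_paired perm_length_paired)

end

text \<open>Reading from the left, the letter at \<open>Suc (2 * k)\<close> has its partner in a
  neighbouring position. The left neighbour already belongs to a completed block, so the partner
  follows, and the word splits into blocks.\<close>

lemma wachs_even_decompose:
  assumes w: "x \<in> wachs (2 * m)"
  obtains \<tau> E where "\<tau> permutes {1..m}" "E \<subseteq> {1..m}" "x = paired \<tau> E"
proof -
  have x: "x permutes {1..2 * m}"
    and close: "a \<in> {1..2 * m} \<Longrightarrow> b \<in> {1..2 * m} \<Longrightarrow> block (x a) = block (x b) \<Longrightarrow> a \<le> b + 1" for a b
    using w by (auto simp: wachs_iff)
  have xinj: "x a = x b \<longleftrightarrow> a = b" for a b using permutes_inj[OF x] by (auto dest: injD)
  \<comment> \<open>A block consists of at most two letters, and distinct positions carry distinct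
    letters.\<close>
  have three: "a = b \<or> b = c \<or> a = c" if "block (x a) = block (x b)" "block (x b) = block (x c)" for a b c
  proof -
    have "x a = x b \<or> x b = x c \<or> x a = x c" using that by linarith
    then show ?thesis by (simp add: xinj)
  qed
  have pair: "block (x (Suc (2 * k))) = block (x (2 * Suc k))" if "k < m" for k
    using that
  proof (induction k rule: less_induct)
    case (less k)
    let ?a = "Suc (2 * k)"
    have a: "?a \<in> {1..2 * m}" using less.prems by auto
    have xa: "1 \<le> x ?a \<and> x ?a \<le> 2 * m" using permutes_range[OF x, of ?a] a by auto
    \<comment> \<open>The other letter of the block of \<open>x ?a\<close>.\<close>
    define y where "y = (if even (x ?a) then x ?a - 1 else x ?a + 1)"
    have "y \<in> {1..2 * m} \<and> block y = block (x ?a) \<and> y \<noteq> x ?a"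
      using xa by (auto simp: y_def elim!: evenE oddE; presburger)
    then have y: "y \<in> {1..2 * m}" "block y = block (x ?a)" "y \<noteq> x ?a" by auto
    have "y \<in> x ` {1..2 * m}" using y(1) permutes_image[OF x] by simp
    then obtain b where b: "b \<in> {1..2 * m}" "x b = y" by auto
    have ne: "b \<noteq> ?a" using b y by auto
    have "b \<le> ?a + 1" "?a \<le> b + 1" using close[OF b(1) a] close[OF a b(1)] b y by auto
    then consider "b = 2 * Suc k" | "b = 2 * k" using ne by force
    then show ?case
    proof cases
      case 1
      then show ?thesis using b y by simp
    next
      case 2
      \<comment> \<open>Position \<open>2 * k\<close> completes the preceding pair, so three
        positions would share one block.\<close>
      then obtain k' where k': "k = Suc k'" using b by (cases k) auto
      have "block (x (Suc (2 * k'))) = block (x b)" using less.IH[of k'] less.prems 2 k' by simp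
      moreover have "block (x b) = block (x ?a)" using b y by simp
      ultimately show ?thesis using three[of "Suc (2 * k')" b ?a] 2 k' by auto
    qed
  qed
  define \<tau> where "\<tau> k = block (x (2 * k))" for k
  \<comment> \<open>The second position of a block holds its odd, smaller letter exactly when the
    block descends.\<close>
  define E where "E = {k \<in> {1..m}. odd (x (2 * k))}"
  have E: "E \<subseteq> {1..m}" by (auto simp: E_def)
  have \<tau>: "\<tau> permutes {1..m}"
  proof (rule inj_permutesI)
    show "inj_on \<tau> {1..m}"
    proof (rule inj_onI)
      fix k l assume k: "k \<in> {1..m}" and l: "l \<in> {1..m}" and eq: "\<tau> k = \<tau> l"
      obtain k' where k': "k = Suc k'" using k by (cases k) auto
      have "block (x (Suc (2 * k'))) = block (x (2 * k))" using pair[of k'] k k' by simp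
      then show "k = l" using three[of "Suc (2 * k')" "2 * k" "2 * l"] eq k' l
        by (auto simp: \<tau>_def)
    qed
    show "1 \<le> \<tau> k \<and> \<tau> k \<le> m" if "1 \<le> k" "k \<le> m" for k
      using permutes_range[OF x, of "2 * k"] that by (auto simp: \<tau>_def)
    show "\<tau> k = k" if "k \<notin> {1..m}" for k
      using permutes_not_in[OF x, of "2 * k"] that by (auto simp: \<tau>_def)
  qed
  have "x i = paired \<tau> E i" for i
  proof (cases "i \<in> {1..2 * m}")
    case False
    then show ?thesis
      using permutes_not_in[OF x False] permutes_not_in[OF paired_permutes[OF \<tau> E] False] by simp
  next
    case True
    define k where "k = (i - 1) div 2"
    have k: "k < m" "i = Suc (2 * k) \<or> i = 2 * Suc k" using True by (auto simp: k_def)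
    have p: "1 \<le> x (2 * Suc k)" using permutes_range[OF x, of "2 * Suc k"] k by auto
    have ev: "x (2 * Suc k) = 2 * \<tau> (Suc k) - of_bool (Suc k \<in> E)"
      using p k by (auto simp: \<tau>_def E_def elim!: evenE oddE)
    have "x (Suc (2 * k)) \<noteq> x (2 * Suc k)" by (simp add: xinj)
    then have od: "x (Suc (2 * k)) = 2 * \<tau> (Suc k) - 1 + of_bool (Suc k \<in> E)"
      using pair[OF k(1)] p k(1) unfolding \<tau>_def E_def
      by (cases "odd (x (2 * Suc k))") (auto simp del: mult_Suc_right elim!: evenE oddE; presburger)+
    show ?thesis using k(2) ev od unfolding paired_even paired_odd
      by (metis paired_even paired_odd)
  qed
  then have "x = paired \<tau> E" by blast
  then show thesis using that \<tau> E by blast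
qed

section \<open>Insertion of the largest letter\<close>

definition insert_max :: "nat \<Rightarrow> nat \<Rightarrow> (nat \<Rightarrow> nat) \<Rightarrow> nat \<Rightarrow> nat" where
  "insert_max N q x i =
    (if i < q then x i else if i = q then Suc N else if i \<le> Suc N then x (i - 1) else i)"

lemma insert_max_decompose:
  assumes v: "v permutes {1..Suc N}"
  obtains q x where "1 \<le> q" "q \<le> Suc N" "x permutes {1..N}" "v = insert_max N q x"
proof -
  have "Suc N \<in> v ` {1..Suc N}" using permutes_image[OF v] by simp
  then obtain q where q: "1 \<le> q" "q \<le> Suc N" "v q = Suc N" by auto
  have vinj: "v a = v b \<longleftrightarrow> a = b" for a b using permutes_inj[OF v] by (auto dest: injD)
  define x where "x i = (if i < q then v i else if i \<le> N then v (Suc i) else i)" for i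
  have vlt: "1 \<le> v i \<and> v i \<le> N" if "1 \<le> i" "i \<le> Suc N" "i \<noteq> q" for i
    using permutes_range[OF v that(1,2)] vinj[of i q] that q(3) by auto
  have "x permutes {1..N}"
  proof (rule inj_permutesI)
    show "inj_on x {1..N}" by (rule inj_onI) (auto simp: x_def vinj split: if_splits)
    show "1 \<le> x i \<and> x i \<le> N" if "1 \<le> i" "i \<le> N" for i
      using that vlt[of i] vlt[of "Suc i"] by (auto simp: x_def)
    show "x i = i" if "i \<notin> {1..N}" for i
      using that q permutes_0[OF v] by (cases "i = 0") (auto simp: x_def)
  qed
  moreover have "v = insert_max N q x"
  proof
    fix i
    show "v i = insert_max N q x i"
      using permutes_not_in[OF v, of i] q by (auto simp: insert_max_def x_def)
  qed
  ultimately show thesis using that q by blast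
qed

context
  fixes N q :: nat and x :: "nat \<Rightarrow> nat"
  assumes x: "x permutes {1..N}" and q: "1 \<le> q" "q \<le> Suc N"
begin

lemma shifted_range: "q < i \<Longrightarrow> i \<le> Suc N \<Longrightarrow> 1 \<le> x (i - 1) \<and> x (i - 1) \<le> N"
  using q by (intro permutes_range[OF x]) auto

lemma insert_max_permutes: "insert_max N q x permutes {1..Suc N}"
proof (rule inj_permutesI)
  have xinj: "x a = x b \<longleftrightarrow> a = b" for a b using permutes_inj[OF x] by (auto dest: injD)
  have xlt: "x i < Suc N" if "1 \<le> i" "i \<le> N" for i using permutes_range[OF x that] by simp
  show "inj_on (insert_max N q x) {1..Suc N}"
  proof (rule inj_onI)
    fix i j assume ij: "i \<in> {1..Suc N}" "j \<in> {1..Suc N}" "insert_max N q x i = insert_max N q x j"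
    have "i < q \<Longrightarrow> x i < Suc N" "j < q \<Longrightarrow> x j < Suc N"
      "q < i \<Longrightarrow> x (i - 1) < Suc N" "q < j \<Longrightarrow> x (j - 1) < Suc N"
      using xlt[of i] xlt[of j] xlt[of "i - 1"] xlt[of "j - 1"] ij q by auto
    then show "i = j" using ij by (auto simp: insert_max_def xinj split: if_splits)
  qed
  show "1 \<le> insert_max N q x i \<and> insert_max N q x i \<le> Suc N" if "1 \<le> i" "i \<le> Suc N" for i
    using permutes_range[OF x, of i] shifted_range[of i] that q
    by (cases i q rule: linorder_cases) (auto simp: insert_max_def)
  show "insert_max N q x i = i" if "i \<notin> {1..Suc N}" for i
    using that q permutes_0[OF x] by (cases "i = 0") (auto simp: insert_max_def)
qed

text \<open>From row \<open>q\<close> on, the new letter is counted at every threshold up to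
  \<open>Suc N\<close>, and the remaining letters are those of one row earlier.\<close>

lemma rk_insert_max:
  assumes "i \<le> Suc N" "j \<le> Suc N"
  shows "rk (insert_max N q x) i j = (if i < q then rk x i j else Suc (rk x (i - 1) j))"
  using assms(1)
proof (induction i)
  case (Suc i)
  then have IH: "rk (insert_max N q x) i j = (if i < q then rk x i j else Suc (rk x (i - 1) j))" by simp
  consider "Suc i < q" | "Suc i = q" | "q \<le> i" by linarith
  then show ?case
  proof cases
    case 3
    then obtain i' where "i = Suc i'" using q by (cases i) auto
    then show ?thesis using 3 Suc.prems unfolding rk_Suc IH by (simp add: insert_max_def rk_Suc)
  next
    case 1
    then show ?thesis unfolding rk_Suc IH by (simp add: insert_max_def rk_Suc)
  next
    case 2
    then show ?thesis using assms(2) unfolding rk_Suc IH by (auto simp: insert_max_def)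
  qed
qed (use q in simp)

text \<open>The old inversions are carried along the shift \<open>s\<close> of positions that skips
  \<open>q\<close>. The new ones pair the largest letter with the \<open>Suc N - q\<close> letters
  to its right.\<close>

lemma perm_length_insert_max: "perm_length (Suc N) (insert_max N q x) = perm_length N x + (Suc N - q)"
proof -
  let ?v = "insert_max N q x"
  define s where "s i = (if i < q then i else Suc i)" for i
  let ?Ix = "{(i, j). i \<in> {1..N} \<and> j \<in> {1..N} \<and> i < j \<and> x i > x j}"
  let ?Iv = "{(i, j). i \<in> {1..Suc N} \<and> j \<in> {1..Suc N} \<and> i < j \<and> ?v i > ?v j}"
  have s_less: "s i < s j \<longleftrightarrow> i < j" for i j by (auto simp: s_def)
  have s_inj: "inj s" by (rule injI) (auto simp: s_def split: if_splits)
  have vs: "?v (s i) = x i" if "i \<le> N" for i using that by (auto simp: s_def insert_max_def)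
  have vq: "?v q = Suc N" by (simp add: insert_max_def)
  have s_ex: "\<exists>i'\<in>{1..N}. i = s i'" if "i \<in> {1..Suc N}" "i \<noteq> q" for i
    using that q by (intro bexI[of _ "if i < q then i else i - 1"]) (auto simp: s_def)
  have vlt: "?v i < Suc N" if "i \<in> {1..Suc N}" "i \<noteq> q" for i
    using s_ex[OF that] vs permutes_range[OF x] by fastforce
  have Iv: "?Iv = map_prod s s ` ?Ix \<union> {q} \<times> {Suc q..Suc N}"
  proof (intro equalityI subsetI)
    fix p assume p: "p \<in> ?Iv"
    obtain i j where ij: "p = (i, j)" by (cases p)
    have h: "i \<in> {1..Suc N}" "j \<in> {1..Suc N}" "i < j" "?v j < ?v i" using p ij by auto
    have jq: "j \<noteq> q" using h vq vlt[of i] by (metis less_asym less_irrefl)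
    show "p \<in> map_prod s s ` ?Ix \<union> {q} \<times> {Suc q..Suc N}"
    proof (cases "i = q")
      case True
      then show ?thesis using h ij by auto
    next
      case False
      obtain i' j' where i': "i' \<in> {1..N}" "i = s i'" and j': "j' \<in> {1..N}" "j = s j'"
        using s_ex[OF h(1) False] s_ex[OF h(2) jq] by blast
      then have "(i', j') \<in> ?Ix" using h vs s_less by auto
      then have "map_prod s s (i', j') \<in> map_prod s s ` ?Ix" by (rule imageI)
      then show ?thesis using ij i' j' by simp
    qed
  next
    fix p assume "p \<in> map_prod s s ` ?Ix \<union> {q} \<times> {Suc q..Suc N}"
    then show "p \<in> ?Iv"
    proof
      assume "p \<in> map_prod s s ` ?Ix"
      then obtain i j where p: "p = (s i, s j)" and h: "i \<in> {1..N}" "j \<in> {1..N}" "i < j" "x j < x i"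
        by auto
      have "s i \<in> {1..Suc N}" "s j \<in> {1..Suc N}" using h by (auto simp: s_def)
      then show ?thesis using h vs by (simp add: p s_less)
    next
      assume "p \<in> {q} \<times> {Suc q..Suc N}"
      then show ?thesis using q vq vlt by auto
    qed
  qed
  have fin: "finite ?Ix" by (rule finite_subset[of _ "{1..N} \<times> {1..N}"]) auto
  have "card ?Iv = card (map_prod s s ` ?Ix) + card ({q} \<times> {Suc q..Suc N})"
    unfolding Iv
  proof (rule card_Un_disjoint)
    show "finite (map_prod s s ` ?Ix)" using fin by (rule finite_imageI)
    show "map_prod s s ` ?Ix \<inter> {q} \<times> {Suc q..Suc N} = {}"
    proof (rule equals0I)
      fix r assume "r \<in> map_prod s s ` ?Ix \<inter> {q} \<times> {Suc q..Suc N}"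
      then obtain i where "s i = q" by auto
      then show False by (simp add: s_def split: if_splits)
    qed
  qed simp
  moreover have "card (map_prod s s ` ?Ix) = card ?Ix"
    by (rule card_image[OF inj_on_subset[OF prod.inj_map[OF s_inj s_inj] subset_UNIV]])
  moreover have "card ({q} \<times> {Suc q..Suc N}) = Suc N - q" by (simp add: card_cartesian_product)
  ultimately show ?thesis unfolding perm_length_def by linarith
qed

lemma chi_insert_max: "chi (Suc N) (insert_max N q x) = x"
proof -
  let ?v = "insert_max N q x"
  have vlt: "?v i \<noteq> Suc N" if "1 \<le> i" "i \<le> Suc N" "i \<noteq> q" for i
    using permutes_range[OF x, of i] shifted_range[of i] that q
    by (cases i q rule: linorder_cases) (auto simp: insert_max_def)
  have split: "[1..<Suc N + 1] = [1..<q] @ q # [Suc q..<Suc N + 1]"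
    using q upt_add_eq_append[of 1 q "Suc N + 1 - q"] upt_conv_Cons[of q "Suc N + 1"]
    by (simp del: upt_Suc)
  have "filter (\<lambda>y. y \<noteq> Suc N) (map ?v [1..<q]) = map x [1..<q]"
  proof -
    have "filter (\<lambda>y. y \<noteq> Suc N) (map ?v [1..<q]) = map ?v [1..<q]"
      using vlt q by (intro filter_True) auto
    also have "\<dots> = map x [1..<q]" by (simp add: insert_max_def)
    finally show ?thesis .
  qed
  moreover have "filter (\<lambda>y. y \<noteq> Suc N) (map ?v [Suc q..<Suc N + 1]) = map x [q..<N + 1]"
  proof -
    have "filter (\<lambda>y. y \<noteq> Suc N) (map ?v [Suc q..<Suc N + 1]) = map ?v [Suc q..<Suc N + 1]"
      using vlt by (intro filter_True) auto
    also have "\<dots> = map (?v \<circ> Suc) [q..<N + 1]" by (simp add: map_Suc_upt flip: map_map)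
    also have "\<dots> = map x [q..<N + 1]" by (auto simp: insert_max_def)
    finally show ?thesis .
  qed
  moreover have "?v q = Suc N" by (simp add: insert_max_def)
  ultimately have "filter (\<lambda>y. y \<noteq> Suc N) (word_of (Suc N) ?v) = map x [1..<q] @ map x [q..<N + 1]"
    unfolding word_of_def split by simp
  also have "\<dots> = map x [1..<N + 1]"
    using q upt_add_eq_append[of 1 q "N + 1 - q"] by (simp del: upt_Suc)
  finally have "chi (Suc N) ?v = of_word (map x [1..<N + 1])" by (simp add: chi_def)
  also have "\<dots> = x"
  proof
    fix i
    show "of_word (map x [1..<N + 1]) i = x i"
      using permutes_not_in[OF x, of i] by (auto simp: of_word_def simp del: upt_Suc)
  qed
  finally show ?thesis .
qed

end

section \<open>Interpolation\<close>

lemma rk_at_0 [simp]: "rk u i 0 = i"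
  by (induction i) (simp_all add: rk_Suc)

text \<open>By \<open>rk_paired\<close>, all entries are sums of entries for the block permutations,
  except at odd rows and even columns; these exceptional entries make up the second
  condition.\<close>

lemma rk_le_paired:
  assumes "\<tau> permutes {1..m}" "E \<subseteq> {1..m}" "\<sigma> permutes {1..m}" "F \<subseteq> {1..m}"
  shows "rk_le (paired \<tau> E) (paired \<sigma> F) \<longleftrightarrow> rk_le \<tau> \<sigma> \<and>
    (\<forall>k l. rk \<tau> k l + rk \<tau> (Suc k) (Suc l) + of_bool (\<tau> (Suc k) = l \<and> Suc k \<in> E) \<le>
           rk \<sigma> k l + rk \<sigma> (Suc k) (Suc l) + of_bool (\<sigma> (Suc k) = l \<and> Suc k \<in> F))"
    (is "?L \<longleftrightarrow> ?A \<and> ?B")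
proof
  note rks = rk_paired[OF assms(1,2)] rk_paired[OF assms(3,4)]
  assume L: ?L
  have "rk \<tau> k j \<le> rk \<sigma> k j" for k j
  proof (cases j)
    case (Suc l)
    have "rk (paired \<tau> E) (2 * k) (Suc (2 * l)) \<le> rk (paired \<sigma> F) (2 * k) (Suc (2 * l))"
      using L by (simp only: rk_le_def)
    then show ?thesis unfolding rks Suc by simp
  qed simp
  then have ?A by (simp add: rk_le_def)
  moreover have ?B
  proof (intro allI)
    fix k l
    have "rk (paired \<tau> E) (Suc (2 * k)) (2 * l) \<le> rk (paired \<sigma> F) (Suc (2 * k)) (2 * l)"
      using L by (simp only: rk_le_def)
    then show "rk \<tau> k l + rk \<tau> (Suc k) (Suc l) + of_bool (\<tau> (Suc k) = l \<and> Suc k \<in> E) \<le>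
           rk \<sigma> k l + rk \<sigma> (Suc k) (Suc l) + of_bool (\<sigma> (Suc k) = l \<and> Suc k \<in> F)"
      unfolding rks .
  qed
  ultimately show "?A \<and> ?B" ..
next
  note rks = rk_paired[OF assms(1,2)] rk_paired[OF assms(3,4)]
  assume AB: "?A \<and> ?B"
  then have A: "rk \<tau> k l \<le> rk \<sigma> k l" for k l by (simp only: rk_le_def)
  show ?L unfolding rk_le_def
  proof (intro allI)
    fix i j
    show "rk (paired \<tau> E) i j \<le> rk (paired \<sigma> F) i j"
    proof (cases i rule: nat_even_odd_cases; cases j rule: nat_even_odd_cases)
      fix k l assume ij: "i = 2 * k" "j = 2 * l"
      show ?thesis unfolding ij rks by (intro add_mono A)
    next
      fix k l assume ij: "i = 2 * k" "j = Suc (2 * l)"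
      show ?thesis unfolding ij rks by (intro mult_left_mono A) simp
    next
      fix k l assume ij: "i = Suc (2 * k)" "j = 2 * l"
      show ?thesis unfolding ij rks using AB by blast
    next
      fix k l assume ij: "i = Suc (2 * k)" "j = Suc (2 * l)"
      show ?thesis unfolding ij rks by (intro add_mono A)
    qed
  qed
qed

text \<open>Making a block descending raises a single entry of the rank matrix, so it needs room
  only there. Exchanging two descending blocks and making them ascending changes the Wachs length by
  \<open>3 - 2 = 1\<close>.\<close>

lemma paired_interpolate:
  assumes \<tau>: "\<tau> permutes {1..m}" and E: "E \<subseteq> {1..m}"
    and \<sigma>: "\<sigma> permutes {1..m}" and F: "F \<subseteq> {1..m}"
    and le: "rk_le (paired \<tau> E) (paired \<sigma> F)" and ne: "paired \<tau> E \<noteq> paired \<sigma> F"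
  obtains \<tau>' E' where "\<tau>' permutes {1..m}" "E' \<subseteq> {1..m}"
    "rk_le (paired \<tau> E) (paired \<tau>' E')" "rk_le (paired \<tau>' E') (paired \<sigma> F)"
    "3 * perm_length m \<tau>' + card E' = Suc (3 * perm_length m \<tau> + card E)"
proof -
  note found = that
  have finE: "finite E" using E finite_subset by blast
  have A: "rk_le \<tau> \<sigma>" and B: "rk \<tau> k l + rk \<tau> (Suc k) (Suc l) + of_bool (\<tau> (Suc k) = l \<and> Suc k \<in> E) \<le>
      rk \<sigma> k l + rk \<sigma> (Suc k) (Suc l) + of_bool (\<sigma> (Suc k) = l \<and> Suc k \<in> F)" for k l
    using le rk_le_paired[OF \<tau> E \<sigma> F] by blast+
  have A': "rk \<tau> k l \<le> rk \<sigma> k l" for k l using A by (simp add: rk_le_def)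
  \<comment> \<open>The hypothesis \<open>lt\<close> is the room at the single entry that changes
    when the block \<open>Suc k\<close> becomes descending.\<close>
  have flip: thesis if k: "Suc k \<in> {1..m} - E" and
    lt: "rk \<tau> k (\<tau> (Suc k)) + rk \<tau> (Suc k) (Suc (\<tau> (Suc k))) <
      rk \<sigma> k (\<tau> (Suc k)) + rk \<sigma> (Suc k) (Suc (\<tau> (Suc k))) + of_bool (\<sigma> (Suc k) = \<tau> (Suc k) \<and> Suc k \<in> F)" for k
  proof (rule found[OF \<tau>])
    let ?E = "insert (Suc k) E"
    show E': "?E \<subseteq> {1..m}" using E k by auto
    show "rk_le (paired \<tau> E) (paired \<tau> ?E)" unfolding rk_le_paired[OF \<tau> E \<tau> E']
      by (auto simp: of_bool_def)
    show "rk_le (paired \<tau> ?E) (paired \<sigma> F)" unfolding rk_le_paired[OF \<tau> E' \<sigma> F]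
    proof (intro conjI A allI)
      fix k' l
      show "rk \<tau> k' l + rk \<tau> (Suc k') (Suc l) + of_bool (\<tau> (Suc k') = l \<and> Suc k' \<in> ?E) \<le>
        rk \<sigma> k' l + rk \<sigma> (Suc k') (Suc l) + of_bool (\<sigma> (Suc k') = l \<and> Suc k' \<in> F)"
        using B[of k' l] lt k by (cases "k' = k \<and> l = \<tau> (Suc k)") auto
    qed
    show "3 * perm_length m \<tau> + card ?E = Suc (3 * perm_length m \<tau> + card E)"
      using k finE by simp
  qed
  show thesis
  proof (cases "\<tau> = \<sigma>")
    case True
    have "E \<subseteq> F"
    proof
      fix i assume i: "i \<in> E"
      then obtain k where k: "i = Suc k" using E by (cases i) auto
      show "i \<in> F" using B[of k "\<tau> (Suc k)"] i True by (auto simp: k of_bool_def split: if_splits)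
    qed
    moreover have "E \<noteq> F" using ne True by auto
    ultimately obtain i where i: "i \<in> F" "i \<notin> E" by blast
    then obtain k where k: "i = Suc k" using F by (cases i) auto
    show thesis by (rule flip[of k]) (use i F True in \<open>auto simp: k\<close>)
  next
    case False
    obtain a b where ab: "1 \<le> a" "a < b" "b \<le> m" and before: "\<And>c. c < a \<Longrightarrow> \<tau> c = \<sigma> c"
      and \<tau>ab: "\<tau> a < \<tau> b" and \<tau>\<sigma>: "\<tau> a < \<sigma> a"
      and gap: "\<And>c. a < c \<Longrightarrow> c < b \<Longrightarrow> \<tau> c < \<tau> a \<or> \<tau> b < \<tau> c"
      and strict: "\<And>i j. a \<le> i \<Longrightarrow> i < b \<Longrightarrow> \<tau> a < j \<Longrightarrow> j \<le> \<tau> b \<Longrightarrow> rk \<tau> i j < rk \<sigma> i j"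
      using rk_le_first_difference[OF \<tau> \<sigma> A False] by metis
    obtain a' b' where a': "a = Suc a'" and b': "b = Suc b'" using ab by (cases a; cases b) auto
    consider "a \<notin> E" | "b \<notin> E" | "a \<in> E" "b \<in> E" by blast
    then show thesis
    proof cases
      case 1
      \<comment> \<open>The room for block \<open>a\<close> comes from the second summand of its
        entry, the one for block \<open>b\<close> below from the first; both are corners of the
        rectangle in \<open>strict\<close>.\<close>
      have "rk \<tau> a (Suc (\<tau> a)) < rk \<sigma> a (Suc (\<tau> a))"
        using strict[of a "Suc (\<tau> a)"] ab \<tau>ab by simp
      then show thesis using A'[of a' "\<tau> a"] 1 ab by (intro flip[of a']) (auto simp: a')
    next
      case 2
      have "rk \<tau> b' (\<tau> b) < rk \<sigma> b' (\<tau> b)" using strict[of b' "\<tau> b"] ab \<tau>ab by (simp add: b')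
      then show thesis using A'[of b "Suc (\<tau> b)"] 2 ab by (intro flip[of b']) (auto simp: b')
    next
      case 3
      let ?\<tau> = "\<tau> \<circ> transpose a b" and ?E = "E - {a, b}"
      have \<tau>': "?\<tau> permutes {1..m}" by (intro permutes_compose permutes_swap_id \<tau>) (use ab in auto)
      have E': "?E \<subseteq> {1..m}" using E by auto
      have rk': "rk ?\<tau> i j = rk \<tau> i j + of_bool (a \<le> i \<and> i < b \<and> \<tau> a < j \<and> j \<le> \<tau> b)" for i j
        using rk_transpose[OF ab(1,2) \<tau>ab] .
      have low: "rk \<tau> i j \<le> rk ?\<tau> i j" for i j by (simp add: rk')
      have high: "rk ?\<tau> i j \<le> rk \<sigma> i j" for i j
        using strict[of i j] A'[of i j] by (simp add: rk' of_bool_def Suc_le_eq)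
      show thesis
      proof (rule found[OF \<tau>' E'])
        show "rk_le (paired \<tau> E) (paired ?\<tau> ?E)" unfolding rk_le_paired[OF \<tau> E \<tau>' E']
        proof (intro conjI allI)
          show "rk_le \<tau> ?\<tau>" using low by (simp add: rk_le_def)
          fix k l
          have lows: "rk \<tau> k l \<le> rk ?\<tau> k l" "rk \<tau> (Suc k) (Suc l) \<le> rk ?\<tau> (Suc k) (Suc l)" by (rule low)+
          \<comment> \<open>At \<open>a\<close> and at \<open>b\<close> the lost descent is balanced
            by a corner of the rectangle on which the exchange raises the rank matrix of
            \<open>\<tau>\<close>. The other descending blocks are unchanged.\<close>
          consider "Suc k = a" "l = \<tau> a" | "Suc k = b" "l = \<tau> b"
            | "\<not> (\<tau> (Suc k) = l \<and> Suc k \<in> E)"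
            | "Suc k \<noteq> a" "Suc k \<noteq> b" "\<tau> (Suc k) = l" "Suc k \<in> E" by blast
          then show "rk \<tau> k l + rk \<tau> (Suc k) (Suc l) + of_bool (\<tau> (Suc k) = l \<and> Suc k \<in> E)
            \<le> rk ?\<tau> k l + rk ?\<tau> (Suc k) (Suc l) + of_bool (?\<tau> (Suc k) = l \<and> Suc k \<in> ?E)"
          proof cases
            case 1
            then have "rk ?\<tau> (Suc k) (Suc l) = Suc (rk \<tau> (Suc k) (Suc l))"
              using ab \<tau>ab by (simp add: rk')
            then show ?thesis using lows by (simp add: of_bool_def)
          next
            case 2
            then have "rk ?\<tau> k l = Suc (rk \<tau> k l)"
              using ab \<tau>ab by (simp add: rk')
            then show ?thesis using lows by (simp add: of_bool_def)
          next
            case 3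
            then show ?thesis using lows by (simp add: of_bool_def)
          next
            case 4
            then have "?\<tau> (Suc k) = l \<and> Suc k \<in> ?E" by (simp add: transpose_def)
            then show ?thesis using lows by (simp add: of_bool_def)
          qed
        qed
        show "rk_le (paired ?\<tau> ?E) (paired \<sigma> F)" unfolding rk_le_paired[OF \<tau>' E' \<sigma> F]
        proof (intro conjI allI)
          show "rk_le ?\<tau> \<sigma>" using high by (simp add: rk_le_def)
          fix k l
          have highs: "rk ?\<tau> k l \<le> rk \<sigma> k l" "rk ?\<tau> (Suc k) (Suc l) \<le> rk \<sigma> (Suc k) (Suc l)"
            by (rule high)+
          show "rk ?\<tau> k l + rk ?\<tau> (Suc k) (Suc l) + of_bool (?\<tau> (Suc k) = l \<and> Suc k \<in> ?E)
            \<le> rk \<sigma> k l + rk \<sigma> (Suc k) (Suc l) + of_bool (\<sigma> (Suc k) = l \<and> Suc k \<in> F)"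
          proof (cases "?\<tau> (Suc k) = l \<and> Suc k \<in> ?E")
            case True
            then have k: "Suc k \<noteq> a" "Suc k \<noteq> b" "\<tau> (Suc k) = l" "Suc k \<in> E"
              by (auto simp: transpose_def split: if_splits)
            have l: "l \<noteq> \<tau> a" "l \<noteq> \<tau> b" using k permutes_inj[OF \<tau>] by (auto dest: injD)
            \<comment> \<open>By \<open>gap\<close>, an unmoved descending block lies outside the
              rectangle. Both summands of its entry are then as for \<open>\<tau>\<close>, and
              \<open>B\<close> applies.\<close>
            have "\<not> (a < Suc k \<and> Suc k < b \<and> \<tau> a < l \<and> l < \<tau> b)" using gap[of "Suc k"] k by auto
            then have "rk ?\<tau> k l = rk \<tau> k l" "rk ?\<tau> (Suc k) (Suc l) = rk \<tau> (Suc k) (Suc l)"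
              using k l unfolding rk' by (auto simp: of_bool_def)
            then show ?thesis using B[of k l] k True by simp
          next
            case False
            then have "of_bool (?\<tau> (Suc k) = l \<and> Suc k \<in> ?E) = (0::nat)"
              by (simp only: of_bool_def if_False)
            then show ?thesis using highs by linarith
          qed
        qed
        have "perm_length m ?\<tau> = Suc (perm_length m \<tau>)"
          using perm_length_transpose(2)[OF \<tau> ab \<tau>ab gap] .
        moreover have "card E = Suc (Suc (card ?E))"
        proof -
          have "card E = Suc (card (E - {a}))" using 3 finE by (metis card_Suc_Diff1)
          also have "card (E - {a}) = Suc (card (E - {a} - {b}))"
            using 3 finE ab by (intro card_Suc_Diff1[symmetric]) auto
          also have "E - {a} - {b} = ?E" by blast
          finally show ?thesis .
        qed
        ultimately show "3 * perm_length m ?\<tau> + card ?E = Suc (3 * perm_length m \<tau> + card E)" by simp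
      qed
    qed
  qed
qed

section \<open>Moves of blocks and of the largest letter as transpositions\<close>

text \<open>Written as a transposition of neighbouring positions, the move becomes accessible to
  \<open>rk_transpose\<close> when a largest letter is present.\<close>

lemma paired_flip:
  assumes "Suc k \<notin> E" "1 \<le> \<tau> (Suc k)"
  shows "paired \<tau> (insert (Suc k) E) = paired \<tau> E \<circ> transpose (Suc (2 * k)) (2 * Suc k)"
proof
  fix i
  have [simp]: "Suc (2 * l) \<noteq> 2 * l'" for l l' :: nat by presburger
  show "paired \<tau> (insert (Suc k) E) i = (paired \<tau> E \<circ> transpose (Suc (2 * k)) (2 * Suc k)) i"
  proof (cases i rule: nat_even_odd_cases)
    case (1 l)
    have "transpose (Suc (2 * k)) (2 * Suc k) i = (if l = Suc k then Suc (2 * k) else 2 * l)"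
      using 1 unfolding transpose_def by (simp del: mult_Suc_right)
    then show ?thesis using 1 assms by (simp add: paired_even paired_odd del: mult_Suc_right)
  next
    case (2 l)
    have "transpose (Suc (2 * k)) (2 * Suc k) i = (if l = k then 2 * Suc k else Suc (2 * l))"
      using 2 unfolding transpose_def by (simp del: mult_Suc_right)
    then show ?thesis using 2 assms by (simp add: paired_even paired_odd del: mult_Suc_right)
  qed
qed

lemma insert_max_comp_transpose:
  assumes "a < q" "b < q"
  shows "insert_max N q (x \<circ> transpose a b) = insert_max N q x \<circ> transpose a b"
proof
  fix i
  show "insert_max N q (x \<circ> transpose a b) i = (insert_max N q x \<circ> transpose a b) i"
    using assms by (auto simp: insert_max_def transpose_def)
qed

text \<open>With \<open>c = \<tau> (Suc k)\<close>, the three positions concerned read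
  \<open>2c, 2c - 1, 2m + 1\<close>; exchanging the outer two gives
  \<open>2m + 1, 2c - 1, 2c\<close>. So the largest letter passes a descending block, which becomes
  ascending.\<close>

lemma insert_max_move:
  assumes k: "Suc k \<in> E" "Suc k \<le> m" "1 \<le> \<tau> (Suc k)"
  shows "insert_max (2 * m) (Suc (2 * k)) (paired \<tau> (E - {Suc k})) =
    insert_max (2 * m) (Suc (2 * Suc k)) (paired \<tau> E) \<circ> transpose (Suc (2 * k)) (Suc (2 * Suc k))"
    (is "?l = ?r")
proof
  fix i
  have other: "paired \<tau> (E - {Suc k}) j = paired \<tau> E j" if "j \<noteq> Suc (2 * k)" "j \<noteq> 2 * Suc k" for j
    using that by (cases j rule: nat_even_odd_cases) (auto simp: paired_even paired_odd)
  consider "i \<le> 2 * k" | "i = Suc (2 * k)" | "i = 2 * Suc k" | "i = Suc (2 * Suc k)" | "Suc (2 * Suc k) < i"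
    by fastforce
  then show "?l i = ?r i"
  proof cases
    case 1
    then show ?thesis using other[of i] by (simp add: insert_max_def transpose_def)
  next
    case 2
    then show ?thesis by (simp add: insert_max_def)
  next
    case 3
    have "?l i = paired \<tau> (E - {Suc k}) (Suc (2 * k))" using 3 k by (simp add: insert_max_def)
    also have "\<dots> = paired \<tau> E (2 * Suc k)" unfolding paired_odd paired_even using k by simp
    also have "\<dots> = ?r i" using 3 by (simp add: insert_max_def transpose_def)
    finally show ?thesis .
  next
    case 4
    have "?l i = paired \<tau> (E - {Suc k}) (2 * Suc k)" using 4 k by (simp add: insert_max_def)
    also have "\<dots> = paired \<tau> E (Suc (2 * k))" unfolding paired_odd paired_even using k by simp
    also have "\<dots> = ?r i" using 4 by (simp add: insert_max_def)
    finally show ?thesis .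
  next
    case 5
    then show ?thesis using other[of "i - 1"] by (auto simp: insert_max_def transpose_def)
  qed
qed

context
  fixes m p :: nat and \<tau> :: "nat \<Rightarrow> nat" and E :: "nat set"
  assumes \<tau>: "\<tau> permutes {1..m}" and E: "E \<subseteq> {1..m}" and p: "p \<le> m"
begin

text \<open>The largest letter is alone in its block, and inserting it between two blocks of
  positions separates no pair.\<close>

lemma insert_max_paired_wachs: "insert_max (2 * m) (Suc (2 * p)) (paired \<tau> E) \<in> wachs (Suc (2 * m))"
  (is "?v \<in> _")
  unfolding wachs_iff
proof (intro conjI ballI impI)
  note x = paired_permutes[OF \<tau> E]
  show "?v permutes {1..Suc (2 * m)}" using insert_max_permutes[OF x] p by simp
  fix a b assume a: "a \<in> {1..Suc (2 * m)}" and b: "b \<in> {1..Suc (2 * m)}"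
    and eq: "block (?v a) = block (?v b)"
  \<comment> \<open>For \<open>a\<close> other than the inserted position, \<open>s a\<close> is the
    position of the same letter in \<open>paired \<tau> E\<close>.\<close>
  define s where "s a = (if a < Suc (2 * p) then a else a - 1)" for a
  have v: "?v a = paired \<tau> E (s a) \<and> 1 \<le> s a \<and> s a \<le> 2 * m"
    if "a \<in> {1..Suc (2 * m)}" "a \<noteq> Suc (2 * p)" for a
    using that p by (auto simp: s_def insert_max_def)
  have vb: "block (?v a) = \<tau> (block (s a)) \<and> block (?v a) \<le> m"
    if "a \<in> {1..Suc (2 * m)}" "a \<noteq> Suc (2 * p)" for a
  proof -
    have "\<tau> (block (s a)) \<le> m" using permutes_range[OF \<tau>, of "block (s a)"] v[OF that] by auto
    then show ?thesis using v[OF that] block_paired[OF \<tau> E, of "s a"] by simp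
  qed
  have vp: "block (?v (Suc (2 * p))) = Suc m" by (simp add: insert_max_def)
  show "a \<le> b + 1"
  proof (cases "a = Suc (2 * p) \<or> b = Suc (2 * p)")
    case True
    then show ?thesis using vp vb[OF a] vb[OF b] eq by (metis Suc_n_not_le_n le_add1)
  next
    case False
    then have "\<tau> (block (s a)) = \<tau> (block (s b))" using vb[OF a] vb[OF b] eq by simp
    then have bl: "block (s a) = block (s b)" using permutes_inj[OF \<tau>] by (auto dest: injD)
    then have close: "s a \<le> s b + 1" by linarith
    show ?thesis
    \<comment> \<open>Only across the inserted letter do distances grow, and there the two positions
      belong to different blocks.\<close>
    proof (cases "Suc (2 * p) < a \<and> b < Suc (2 * p)")
      case True
      then have "Suc (2 * p) \<le> s a" "s b \<le> 2 * p" by (auto simp: s_def)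
      then have "Suc p \<le> block (s a)" "block (s b) \<le> p" by linarith+
      then show ?thesis using bl by linarith
    next
      case other: False
      then show ?thesis using close False by (auto simp: s_def split: if_splits)
    qed
  qed
qed

lemma f_wachs_insert_max: "f_wachs (Suc (2 * m)) (insert_max (2 * m) (Suc (2 * p)) (paired \<tau> E)) = \<tau>"
  using chi_insert_max[OF paired_permutes[OF \<tau> E], of "Suc (2 * p)"] p
  by (simp add: f_wachs_def f_even_paired[OF \<tau> E])

lemma wachs_length_insert_max:
  "wachs_length (Suc (2 * m)) (insert_max (2 * m) (Suc (2 * p)) (paired \<tau> E)) =
    int (3 * perm_length m \<tau> + card E + 2 * (m - p))"
  using perm_length_insert_max[OF paired_permutes[OF \<tau> E], of "Suc (2 * p)"] p
  by (simp add: wachs_length_def f_wachs_insert_max perm_length_paired[OF \<tau> E])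

end

text \<open>Deleting the largest letter only shortens distances, so the remaining word is again
  Wachs and splits into blocks. An even position of the largest letter would lie inside a block and
  put its two letters at distance two.\<close>

lemma wachs_odd_decompose:
  assumes w: "v \<in> wachs (Suc (2 * m))"
  obtains p \<tau> E where "p \<le> m" "\<tau> permutes {1..m}" "E \<subseteq> {1..m}"
    "v = insert_max (2 * m) (Suc (2 * p)) (paired \<tau> E)"
proof -
  have v: "v permutes {1..Suc (2 * m)}"
    and close: "a \<in> {1..Suc (2 * m)} \<Longrightarrow> b \<in> {1..Suc (2 * m)} \<Longrightarrow> block (v a) = block (v b) \<Longrightarrow> a \<le> b + 1" for a b
    using w by (auto simp: wachs_iff)
  obtain q x where q: "1 \<le> q" "q \<le> Suc (2 * m)" and x: "x permutes {1..2 * m}"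
    and vx: "v = insert_max (2 * m) q x" using insert_max_decompose[OF v] .
  define s where "s i = (if i < q then i else Suc i)" for i
  have vs: "v (s i) = x i" if "i \<le> 2 * m" for i using that by (auto simp: vx s_def insert_max_def)
  have close': "s a \<le> s b + 1" if "a \<in> {1..2 * m}" "b \<in> {1..2 * m}" "block (x a) = block (x b)" for a b
    using that close[of "s a" "s b"] vs by (auto simp: s_def)
  have "x \<in> wachs (2 * m)" unfolding wachs_iff
  proof (intro conjI ballI impI x)
    fix a b assume "a \<in> {1..2 * m}" "b \<in> {1..2 * m}" "block (x a) = block (x b)"
    from close'[OF this] show "a \<le> b + 1" by (auto simp: s_def split: if_splits)
  qed
  then obtain \<tau> E where \<tau>: "\<tau> permutes {1..m}" and E: "E \<subseteq> {1..m}" and xe: "x = paired \<tau> E"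
    by (rule wachs_even_decompose)
  have "odd q"
  proof
    assume "even q"
    then obtain k where k: "q = 2 * Suc k" using q by (elim evenE) (metis not_one_le_zero mult_0_right not0_implies_Suc)
    have "block (x (2 * Suc k)) = block (x (Suc (2 * k)))"
      unfolding xe block_paired[OF \<tau> E] by simp
    moreover have "Suc k \<le> m" using q by (simp add: k)
    ultimately have "s (2 * Suc k) \<le> s (Suc (2 * k)) + 1" by (intro close') auto
    then show False by (simp add: s_def k)
  qed
  then obtain p where p: "q = Suc (2 * p)" by (elim oddE) simp
  show thesis using that[of p \<tau> E] q \<tau> E vx xe p by simp
qed

text \<open>Each row of \<open>x\<close> reappears as a row of the longer word, up to a constant
  that is the same for \<open>y\<close> because the letter is inserted at the same position.\<close>

lemma rk_le_insert_max:
  assumes x: "x permutes {1..N}" and y: "y permutes {1..N}" and q: "1 \<le> q" "q \<le> Suc N"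
  shows "rk_le (insert_max N q x) (insert_max N q y) \<longleftrightarrow> rk_le x y"
proof
  assume le: "rk_le (insert_max N q x) (insert_max N q y)"
  show "rk_le x y"
  proof (rule rk_leI[OF x y])
    fix i j assume ij: "i \<le> N" "j \<le> N"
    have "rk (insert_max N q x) i j \<le> rk (insert_max N q y) i j"
      "rk (insert_max N q x) (Suc i) j \<le> rk (insert_max N q y) (Suc i) j"
      using le by (auto simp: rk_le_def)
    then show "rk x i j \<le> rk y i j"
      using ij by (cases "i < q") (simp_all add: rk_insert_max[OF x q] rk_insert_max[OF y q])
  qed
next
  assume le: "rk_le x y"
  show "rk_le (insert_max N q x) (insert_max N q y)"
  proof (rule rk_leI[OF insert_max_permutes[OF x q] insert_max_permutes[OF y q]])
    fix i j assume ij: "i \<le> Suc N" "j \<le> Suc N"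
    show "rk (insert_max N q x) i j \<le> rk (insert_max N q y) i j"
      using ij le by (simp add: rk_insert_max[OF x q] rk_insert_max[OF y q] rk_le_def)
  qed
qed

lemma rk_mono: "i \<le> i' \<Longrightarrow> rk u i j \<le> rk u i' j"
  unfolding rk_def by (rule card_mono) auto

section \<open>One-step interpolation between Wachs permutations\<close>

lemma wachs_even_interpolate:
  assumes u: "u \<in> wachs (2 * m)" and v: "v \<in> wachs (2 * m)" and le: "rk_le u v" and ne: "u \<noteq> v"
  shows "\<exists>w\<in>wachs (2 * m). rk_le u w \<and> rk_le w v \<and> wachs_length (2 * m) w = wachs_length (2 * m) u + 1"
proof -
  obtain \<tau> E where \<tau>: "\<tau> permutes {1..m}" "E \<subseteq> {1..m}" and ue: "u = paired \<tau> E"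
    using wachs_even_decompose[OF u] .
  obtain \<sigma> F where \<sigma>: "\<sigma> permutes {1..m}" "F \<subseteq> {1..m}" and ve: "v = paired \<sigma> F"
    using wachs_even_decompose[OF v] .
  obtain \<tau>' E' where \<tau>': "\<tau>' permutes {1..m}" "E' \<subseteq> {1..m}"
    and w: "rk_le (paired \<tau> E) (paired \<tau>' E')" "rk_le (paired \<tau>' E') (paired \<sigma> F)"
    and len: "3 * perm_length m \<tau>' + card E' = Suc (3 * perm_length m \<tau> + card E)"
    using paired_interpolate[OF \<tau> \<sigma>] le ne ue ve by blast
  show ?thesis
    using w len paired_wachs[OF \<tau>'] unfolding ue ve
    by (intro bexI[of _ "paired \<tau>' E'"]) (auto simp: wachs_length_paired[OF \<tau>'] wachs_length_paired[OF \<tau>])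
qed

text \<open>If the largest letter stands in the same place, the blocks are interpolated. Otherwise
  it stands further right in \<open>u\<close>, and the rows of the block to its left have room:
  there \<open>v\<close> already counts the largest letter and \<open>u\<close> does not.\<close>

lemma wachs_odd_interpolate:
  assumes u: "u \<in> wachs (Suc (2 * m))" and v: "v \<in> wachs (Suc (2 * m))"
    and le: "rk_le u v" and ne: "u \<noteq> v"
  shows "\<exists>w\<in>wachs (Suc (2 * m)). rk_le u w \<and> rk_le w v \<and>
    wachs_length (Suc (2 * m)) w = wachs_length (Suc (2 * m)) u + 1"
proof -
  let ?ins = "\<lambda>p. insert_max (2 * m) (Suc (2 * p))"
  obtain p \<tau> E where p: "p \<le> m" and \<tau>: "\<tau> permutes {1..m}" "E \<subseteq> {1..m}" and ue: "u = ?ins p (paired \<tau> E)"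
    using wachs_odd_decompose[OF u] .
  obtain q \<sigma> F where q: "q \<le> m" and \<sigma>: "\<sigma> permutes {1..m}" "F \<subseteq> {1..m}" and ve: "v = ?ins q (paired \<sigma> F)"
    using wachs_odd_decompose[OF v] .
  let ?x = "paired \<tau> E" and ?y = "paired \<sigma> F"
  have x: "?x permutes {1..2 * m}" and y: "?y permutes {1..2 * m}" using paired_permutes \<tau> \<sigma> by blast+
  have pq: "1 \<le> Suc (2 * p)" "Suc (2 * p) \<le> Suc (2 * m)" "1 \<le> Suc (2 * q)" "Suc (2 * q) \<le> Suc (2 * m)"
    using p q by auto
  have le': "rk u i j \<le> rk v i j" for i j using le by (simp add: rk_le_def)
  have rku: "rk u i j = (if i < Suc (2 * p) then rk ?x i j else Suc (rk ?x (i - 1) j))"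
    and rkv: "rk v i j = (if i < Suc (2 * q) then rk ?y i j else Suc (rk ?y (i - 1) j))"
    if "i \<le> Suc (2 * m)" "j \<le> Suc (2 * m)" for i j
    unfolding ue ve using rk_insert_max[OF x pq(1,2) that] rk_insert_max[OF y pq(3,4) that] .
  have "q \<le> p"
  \<comment> \<open>Column \<open>Suc (2 * m)\<close> counts the largest letter alone; at row
    \<open>Suc (2 * p)\<close> it would be present in \<open>u\<close> but still missing in
    \<open>v\<close>.\<close>
  proof (rule ccontr)
    assume "\<not> q \<le> p"
    then show False
      using le'[of "Suc (2 * p)" "Suc (2 * m)"] p
        rk_above[OF y, of "Suc (2 * p)" "Suc (2 * m)"] q
      by (simp add: rku rkv)
  qed
  show ?thesis
  proof (cases "p = q")
    case True
    have "rk_le ?x ?y" using le rk_le_insert_max[OF x y pq(1,2)] by (simp add: ue ve True)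
    moreover have "?x \<noteq> ?y" using ne by (auto simp: ue ve True)
    ultimately obtain \<tau>' E' where \<tau>': "\<tau>' permutes {1..m}" "E' \<subseteq> {1..m}"
      and w: "rk_le ?x (paired \<tau>' E')" "rk_le (paired \<tau>' E') ?y"
      and len: "3 * perm_length m \<tau>' + card E' = Suc (3 * perm_length m \<tau> + card E)"
      using paired_interpolate[OF \<tau> \<sigma>] by blast
    have z: "paired \<tau>' E' permutes {1..2 * m}" using paired_permutes \<tau>' by blast
    show ?thesis
    proof (intro bexI[of _ "?ins p (paired \<tau>' E')"] conjI)
      show "rk_le u (?ins p (paired \<tau>' E'))" "rk_le (?ins p (paired \<tau>' E')) v"
        using rk_le_insert_max[OF x z pq(1,2)] rk_le_insert_max[OF z y pq(1,2)] w
        by (simp_all add: ue ve True)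
      show "wachs_length (Suc (2 * m)) (?ins p (paired \<tau>' E')) = wachs_length (Suc (2 * m)) u + 1"
        using len by (simp add: ue wachs_length_insert_max[OF \<tau> p] wachs_length_insert_max[OF \<tau>' p])
      show "?ins p (paired \<tau>' E') \<in> wachs (Suc (2 * m))" by (rule insert_max_paired_wachs[OF \<tau>' p])
    qed
  next
    case False
    then obtain k where k: "p = Suc k" "q \<le> k" using \<open>q \<le> p\<close> by (cases p) auto
    have base: "rk \<tau> k l \<le> rk \<sigma> k l" for l
    proof (cases "l = 0 \<or> m < l")
      case True
      then show ?thesis using rk_above[OF \<tau>(1), of k l] p k by auto
    next
      case l: False
      then obtain l' where l': "l = Suc l'" by (cases l) auto
      have b: "2 * k \<le> Suc (2 * m)" "Suc (2 * l') \<le> Suc (2 * m)" using l l' p k by auto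
      \<comment> \<open>The largest letter of \<open>v\<close> may already stand in these positions,
        at the cost of one.\<close>
      have "rk v (2 * k) (Suc (2 * l')) \<le> Suc (rk ?y (2 * k) (Suc (2 * l')))"
        unfolding rkv[OF b] using rk_mono[of "2 * k - 1" "2 * k" ?y "Suc (2 * l')"] by auto
      moreover have "rk u (2 * k) (Suc (2 * l')) = rk ?x (2 * k) (Suc (2 * l'))"
        unfolding rku[OF b] using k by simp
      ultimately have "2 * rk \<tau> k l \<le> Suc (2 * rk \<sigma> k l)"
        using le'[of "2 * k" "Suc (2 * l')"] unfolding rk_paired[OF \<tau>] rk_paired[OF \<sigma>] l' by linarith
      \<comment> \<open>The slack of one is lost by parity, since the first \<open>2 * k\<close> positions consist of full blocks.\<close>
      then show ?thesis by linarith
    qed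
    have base': "rk ?x (2 * k) j \<le> rk ?y (2 * k) j" for j
    proof (cases j rule: nat_even_odd_cases)
      case (1 l)
      show ?thesis unfolding 1 rk_paired[OF \<tau>] rk_paired[OF \<sigma>] by (intro add_mono base)
    next
      case (2 l)
      show ?thesis unfolding 2 rk_paired[OF \<tau>] rk_paired[OF \<sigma>] using base by simp
    qed
    \<comment> \<open>In these rows \<open>v\<close> has passed its largest letter and
      \<open>u\<close> has not. The block letters of \<open>u\<close> counted since row
      \<open>2 * k\<close> lie below \<open>j\<close>, so they do not use up the surplus.\<close>
    have room: "rk u i j < rk v i j"
      if i: "i = Suc (2 * k) \<or> i = Suc (Suc (2 * k))" and j: "j \<le> Suc (2 * m)"
        and small: "\<And>a. 2 * k < a \<Longrightarrow> a \<le> i \<Longrightarrow> ?x a < j" for i j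
    proof -
      have im: "i \<le> Suc (2 * m)" using i p k by auto
      have "rk u i j = rk ?x i j" unfolding rku[OF im j] using i k by auto
      also have "\<dots> = rk ?x (2 * k) j" using i small[of "Suc (2 * k)"] small[of "Suc (Suc (2 * k))"]
        by (auto simp: rk_Suc)
      also have "\<dots> \<le> rk ?y (i - 1) j" using base'[of j] rk_mono[of "2 * k" "i - 1" ?y j] i by auto
      finally show ?thesis unfolding rkv[OF im j] using i k by auto
    qed
    define c where "c = \<tau> (Suc k)"
    have c: "1 \<le> c" "c \<le> m" using permutes_range[OF \<tau>(1), of "Suc k"] p k by (auto simp: c_def)
    have xo: "?x (Suc (2 * k)) = 2 * c - 1 + of_bool (Suc k \<in> E)"
      and xe: "?x (Suc (Suc (2 * k))) = 2 * c - of_bool (Suc k \<in> E)"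
      using paired_odd[of \<tau> E k] paired_even[of \<tau> E "Suc k"] by (simp_all add: c_def)
    have interp: "rk_le u (u \<circ> transpose a b) \<and> rk_le (u \<circ> transpose a b) v"
      if "1 \<le> a" "a < b" "u a < u b"
        and "\<And>i j. a \<le> i \<Longrightarrow> i < b \<Longrightarrow> u a < j \<Longrightarrow> j \<le> u b \<Longrightarrow> rk u i j < rk v i j" for a b
      unfolding rk_le_def rk_transpose[OF that(1-3)]
      using that(4) le' by (auto simp: of_bool_def Suc_le_eq)
    have finE: "finite E" using \<tau>(2) finite_subset by blast
    show ?thesis
    proof (cases "Suc k \<in> E")
      case False
      let ?E = "insert (Suc k) E"
      have E': "?E \<subseteq> {1..m}" using \<tau>(2) p k by auto
      have u1: "u (Suc (2 * k)) = 2 * c - 1" and u2: "u (2 * Suc k) = 2 * c"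
        using xo xe False k by (simp_all add: ue insert_max_def)
      \<comment> \<open>An ascending block is reversed by exchanging its two neighbouring
        letters.\<close>
      have w: "?ins p (paired \<tau> ?E) = u \<circ> transpose (Suc (2 * k)) (2 * Suc k)"
        unfolding ue using paired_flip[OF False, of \<tau>] c k
        by (simp add: c_def insert_max_comp_transpose)
      have "rk_le u (?ins p (paired \<tau> ?E)) \<and> rk_le (?ins p (paired \<tau> ?E)) v"
        unfolding w
      proof (rule interp)
        show "rk u i j < rk v i j"
          if "Suc (2 * k) \<le> i" "i < 2 * Suc k" "u (Suc (2 * k)) < j" "j \<le> u (2 * Suc k)" for i j
        proof (rule room)
          show "j \<le> Suc (2 * m)" using that u2 c by simp
          show "?x a < j" if "2 * k < a" "a \<le> i" for a
          proof -
            have "a = Suc (2 * k)" using that \<open>i < 2 * Suc k\<close> by simp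
            then show ?thesis using xo False \<open>u (Suc (2 * k)) < j\<close> u1 by simp
          qed
        qed (use that in auto)
      qed (use u1 u2 c in auto)
      moreover have "?ins p (paired \<tau> ?E) \<in> wachs (Suc (2 * m))"
        by (rule insert_max_paired_wachs[OF \<tau>(1) E' p])
      moreover have "wachs_length (Suc (2 * m)) (?ins p (paired \<tau> ?E)) = wachs_length (Suc (2 * m)) u + 1"
        using False finE by (simp add: ue wachs_length_insert_max[OF \<tau>(1) E' p] wachs_length_insert_max[OF \<tau> p])
      ultimately show ?thesis by blast
    next
      case True
      let ?E = "E - {Suc k}"
      have E': "?E \<subseteq> {1..m}" using \<tau>(2) by auto
      have km: "k \<le> m" using p k by simp
      have u1: "u (Suc (2 * k)) = 2 * c" and u2: "u (Suc (2 * Suc k)) = Suc (2 * m)"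
        using xo True k c by (simp_all add: ue insert_max_def)
      \<comment> \<open>The block descends already, so the largest letter jumps over it.\<close>
      have w: "?ins k (paired \<tau> ?E) = u \<circ> transpose (Suc (2 * k)) (Suc (2 * Suc k))"
        unfolding ue k(1) by (rule insert_max_move) (use True p k c in \<open>auto simp: c_def\<close>)
      have "rk_le u (?ins k (paired \<tau> ?E)) \<and> rk_le (?ins k (paired \<tau> ?E)) v"
        unfolding w
      proof (rule interp)
        show "rk u i j < rk v i j"
          if "Suc (2 * k) \<le> i" "i < Suc (2 * Suc k)" "u (Suc (2 * k)) < j" "j \<le> u (Suc (2 * Suc k))" for i j
        proof (rule room)
          show "j \<le> Suc (2 * m)" using that u2 by simp
          show "?x a < j" if "2 * k < a" "a \<le> i" for a
          proof -
            have "a = Suc (2 * k) \<or> a = Suc (Suc (2 * k))" using that \<open>i < Suc (2 * Suc k)\<close> by auto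
            then show ?thesis using xo xe True \<open>u (Suc (2 * k)) < j\<close> u1 c by auto
          qed
        qed (use that in auto)
      qed (use u1 u2 c in auto)
      moreover have "?ins k (paired \<tau> ?E) \<in> wachs (Suc (2 * m))"
        by (rule insert_max_paired_wachs[OF \<tau>(1) E' km])
      moreover have "wachs_length (Suc (2 * m)) (?ins k (paired \<tau> ?E)) = wachs_length (Suc (2 * m)) u + 1"
      proof -
        \<comment> \<open>One descending block is lost, while \<open>2 * (m - p)\<close> grows by
          two as \<open>p\<close> drops to \<open>k\<close>.\<close>
        have "card E = Suc (card ?E)" using True finE by (metis card_Suc_Diff1)
        moreover have "m - k = Suc (m - p)" using p k by simp
        ultimately show ?thesis
          by (simp add: ue wachs_length_insert_max[OF \<tau>(1) E' km] wachs_length_insert_max[OF \<tau> p])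
      qed
      ultimately show ?thesis by blast
    qed
  qed
qed

section \<open>Extremal Wachs permutations and the conclusion\<close>

lemma paired_id: "paired id {} = id"
proof
  fix i show "paired id {} i = id i"
    by (cases i rule: nat_even_odd_cases) (simp_all add: paired_even paired_odd)
qed

lemma paired_longest: "paired (longest m) {1..m} = longest (2 * m)"
proof
  fix i show "paired (longest m) {1..m} i = longest (2 * m) i"
    by (cases i rule: nat_even_odd_cases) (auto simp: paired_even paired_odd longest_def of_bool_def)
qed

lemma insert_max_id: "insert_max N (Suc N) id = id"
  by (auto simp: insert_max_def)

lemma insert_max_longest: "insert_max N 1 (longest N) = longest (Suc N)"
proof
  fix i show "insert_max N 1 (longest N) i = longest (Suc N) i"
    by (auto simp: insert_max_def longest_def)
qed

text \<open>The identity has ascending blocks in order, with any largest odd letter at the end. The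
  reversed word has descending blocks in reversed order, with that letter in front; its block
  permutation is again the reversal.\<close>

lemma wachs_extremes:
  shows "id \<in> wachs n" "longest n \<in> wachs n" "wachs_length n id = 0"
    "wachs_length n (longest n) = int ((n choose 2) - ((n div 2) choose 2))"
proof -
  note L = longest_permutes[of "n div 2"] order_refl[of "{1..n div 2}"]
  note I = permutes_id[of "{1..n div 2}"] empty_subsetI[of "{1..n div 2}"]
  \<comment> \<open>The nonnegativity of the last length guarantees that the natural-number
    subtraction in the rank is not truncated.\<close>
  have "id \<in> wachs n \<and> longest n \<in> wachs n \<and> wachs_length n id = 0 \<and>
    f_wachs n (longest n) = longest (n div 2) \<and> 0 \<le> wachs_length n (longest n)"
  proof (cases n rule: nat_even_odd_cases)
    case (1 m)
    then have m: "n div 2 = m" by simp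
    show ?thesis
      using paired_wachs[OF I] paired_wachs[OF L] wachs_length_paired[OF I] wachs_length_paired[OF L]
        f_even_paired[OF L]
      unfolding m paired_id paired_longest 1 by (simp add: f_wachs_def perm_length_id)
  next
    case (2 m)
    then have m: "n div 2 = m" by simp
    have id: "insert_max (2 * m) (Suc (2 * m)) (paired id {}) = id"
      unfolding paired_id by (rule insert_max_id)
    have lo: "insert_max (2 * m) (Suc (2 * 0)) (paired (longest m) {1..m}) = longest (Suc (2 * m))"
      unfolding paired_longest using insert_max_longest[of "2 * m"] by simp
    show ?thesis
      using insert_max_paired_wachs[OF I[unfolded m] order_refl] insert_max_paired_wachs[OF L[unfolded m] le0]
        wachs_length_insert_max[OF I[unfolded m] order_refl] wachs_length_insert_max[OF L[unfolded m] le0]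
        f_wachs_insert_max[OF L[unfolded m] le0]
      unfolding id lo m unfolding 2 by (simp add: perm_length_id)
  qed
  then show "id \<in> wachs n" "longest n \<in> wachs n" "wachs_length n id = 0"
    "wachs_length n (longest n) = int ((n choose 2) - ((n div 2) choose 2))"
    by (auto simp: wachs_length_def perm_length_longest)
qed

theorem theorem3p9:
  fixes n :: nat
  assumes "n > 0"
  shows "graded_of_rank (wachs n) (wachs_order n) ((n choose 2) - ((n div 2) choose 2)) \<and>
         rank_function (wachs n) (wachs_order n) (wachs_length n)"
proof (rule graded_by_interpolation[OF partial_order_wachs finite_wachs, where lo = id and hi = "longest n"])
  show "(id, x) \<in> wachs_order n" "(x, longest n) \<in> wachs_order n" if "x \<in> wachs n" for x
    using that wachs_extremes(1,2) rk_le_bot[OF wachs_permutes[OF that]]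
      rk_le_top[OF wachs_permutes[OF that]] by (auto simp: wachs_order_iff)
  fix x y assume xy: "(x, y) \<in> wachs_order n" "x \<noteq> y"
  \<comment> \<open>The parity of \<open>n\<close> selects one of the two interpolation
    lemmas.\<close>
  have "\<exists>w\<in>wachs n. rk_le x w \<and> rk_le w y \<and> wachs_length n w = wachs_length n x + 1"
    using xy wachs_even_interpolate[of x _ y] wachs_odd_interpolate[of x _ y]
    unfolding wachs_order_iff by (cases n rule: nat_even_odd_cases) blast+
  then show "\<exists>z. (x, z) \<in> wachs_order n \<and> (z, y) \<in> wachs_order n \<and> wachs_length n z = wachs_length n x + 1"
    using xy by (auto simp: wachs_order_iff)
qed (use wachs_extremes in auto)

end
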